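(* Let $X=\{X(t),t\ge t_0\}$ be a diffusion process with $X(t_0)=x_0$, and let $a(t)$ and $b(t)$ be two continuous time dependent boundaries, with first hitting times $T_a$ and $T_b$. (i) If $x_0<a(t_0)<b(t_0)$ and $a(t)<b(t)$ for each $t>t_0$, or if $b(t_0)<a(t_0)<x_0$ and $b(t)<a(t)$ for each $t>t_0$, then the joint density of $(T_a,T_b)$ is $$f_{T_a,T_b}(t,s|x_0,t_0)=\begin{cases}0 & t\ge s,\\ f_{T_a}(t|x_0,t_0)\,f_{T_b}(s|a(t),t) & t<s.\end{cases}$$ (ii) If $a(t_0)<x_0<b(t_0)$ and $a(t)<b(t)$ for each $t>t_0$, then the joint density of $(T_a,T_b)$ is $$f_{T_a,T_b}(t,s|x_0,t_0)=\begin{cases} f_{T_b}(s|a(t),t)\,g_a(t|x_0,t_0) & t<s,\\ 0 & t=s,\\ f_{T_a}(t|b(s),s)\,g_b(s|x_0,t_0) & t>s.\end{cases}$$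
   Context: $X=\{X(t),t\ge t_0\}$ is a one-dimensional regular time homogeneous diffusion process on a probability space $(\Omega,\mathcal A,\mathbb P)$ with $P(X(t_0)=x_0)=1$ and diffusion interval $I$ (an interval with endpoints $r_1<r_2$, possibly infinite; unless otherwise specified $I$ is open and $r_1,r_2$ are natural boundaries), having transition distribution function $F_{X(t)}(x|y,\tau)=P(X(t)\le x|X(\tau)=y)$ and transition density $f_{X(t)}(x|y,\tau)$. The boundaries $a(t),b(t)$ take values in $I$ and, as a standing assumption, are continuous with bounded derivatives. The first hitting time of $a$ is $T_a=\inf\{t\ge t_0: X(t)=a(t)\}$, and $T_b$ is defined in the same way for $b$. $F_{T_a}(t|x_0,t_0)=P(T_a\le t|X(t_0)=x_0)$, with density $f_{T_a}(t|x_0,t_0)$, and likewise for $T_b$. More generally, $f_{T_b}(s|y,t)$ (in the variable $s>t$) is the density of the first hitting time of the boundary $b$ by the process that starts from $y$ at time $t$, and likewise $f_{T_a}(t|y,s)$. The joint distribution function is $F_{T_a,T_b}(t,s|x_0,t_0)=P(T_a\le t,T_b\le s|X(t_0)=x_0)$, with joint density $f_{T_a,T_b}(t,s|x_0,t_0)$. Further, when $x_0$ lies between the boundaries, $g_a$ and $g_b$ are the (sub-probability) densities defined by $$g_a(t|x_0,t_0)\,dt=P(T_a\in dt,\ T_a<T_b|X(t_0)=x_0),\qquad g_b(t|x_0,t_0)\,dt=P(T_b\in dt,\ T_a>T_b|X(t_0)=x_0).$$ The existence of these densities is assumed throughout. *)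

theory Defs
  imports "HOL-Probability.Probability"
begin

section \<open>Path space\<close>

text \<open>Paths are indexed by elapsed time \<open>u \<ge> 0\<close>. The sigma-algebra is the trace, on the continuous
  \<open>I\<close>-valued paths, of the product sigma-algebra, i.e. it is generated by the coordinate maps.\<close>

definition path_space :: "real set \<Rightarrow> (real \<Rightarrow> real) measure" where
  "path_space I = restrict_space (PiM {0..} (\<lambda>_. borel))
     {w. continuous_on {0..} w \<and> w ` {0..} \<subseteq> I}"

definition path_filtration :: "real set \<Rightarrow> real \<Rightarrow> (real \<Rightarrow> real) measure" where
  "path_filtration I u = sigma (space (path_space I))
     {{w \<in> space (path_space I). w r \<in> B} | r B. 0 \<le> r \<and> r \<le> u \<and> B \<in> sets borel}"

definition path_shift :: "real \<Rightarrow> (real \<Rightarrow> real) \<Rightarrow> real \<Rightarrow> real" where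
  "path_shift u w = (\<lambda>r\<in>{0..}. w (u + r))"

section \<open>First hitting times\<close>

text \<open>The first hitting time of the boundary \<open>c\<close> by the path \<open>Y\<close> started at time \<open>\<tau>\<close>; it is
  \<open>\<infinity>\<close> if the boundary is never hit.\<close>

definition hitting_time :: "real \<Rightarrow> (real \<Rightarrow> real) \<Rightarrow> (real \<Rightarrow> real) \<Rightarrow> ereal" where
  "hitting_time \<tau> c Y = Inf {ereal t | t. \<tau> \<le> t \<and> Y t = c t}"

section \<open>Diffusions\<close>

text \<open>\<open>Q y\<close> is the law of the process started from \<open>y\<close>, as a function of the elapsed time. By time
  homogeneity, the process started from \<open>y\<close> at time \<open>\<tau>\<close> is \<open>t \<mapsto> w (t - \<tau>)\<close> under \<open>Q y\<close>.

  The strong Markov property is stated for finite stopping times of the natural filtration; applying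
  it to \<open>min T n\<close> extends it to arbitrary stopping times \<open>T\<close> on \<open>T < \<infinity>\<close>.

  A natural boundary is one that can neither be reached in finite time nor be entered. The first
  part holds since paths stay in the open interval for all times; the second is expressed by the
  two limits.\<close>

locale diffusion_family =
  fixes r1 r2 :: ereal and Q :: "real \<Rightarrow> (real \<Rightarrow> real) measure"
  assumes endpoints: "r1 < r2"
    and kernel: "Q \<in> restrict_space borel (einterval r1 r2)
                      \<rightarrow>\<^sub>M prob_algebra (path_space (einterval r1 r2))"
    and start: "\<And>y. y \<in> einterval r1 r2 \<Longrightarrow> AE w in Q y. w 0 = y"
    and strong_Markov:
      "\<And>y T A B. y \<in> einterval r1 r2 \<Longrightarrow>
         stopping_time (path_filtration (einterval r1 r2)) T \<Longrightarrow>
         (\<And>w. w \<in> space (path_space (einterval r1 r2)) \<Longrightarrow> 0 \<le> T w) \<Longrightarrow>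
         A \<in> sets (filtration.pre_sigma (space (path_space (einterval r1 r2)))
                     (path_filtration (einterval r1 r2)) T) \<Longrightarrow>
         B \<in> sets (path_space (einterval r1 r2)) \<Longrightarrow>
         emeasure (Q y) {w \<in> A. path_shift (T w) w \<in> B}
           = (\<integral>\<^sup>+w\<in>A. emeasure (Q (w (T w))) B \<partial>Q y)"
    and regular:
      "\<And>x y. x \<in> einterval r1 r2 \<Longrightarrow> y \<in> einterval r1 r2 \<Longrightarrow>
         0 < measure (Q x) {w \<in> space (Q x). hitting_time 0 (\<lambda>_. y) w < \<infinity>}"
    and transition_density:
      "\<And>y u. y \<in> einterval r1 r2 \<Longrightarrow> 0 < u \<Longrightarrow> \<exists>p. distributed (Q y) lborel (\<lambda>w. w u) p"
    and natural_left:
      "\<And>x u. x \<in> einterval r1 r2 \<Longrightarrow>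
         ((\<lambda>y. measure (Q (real_of_ereal y))
                 {w \<in> space (Q (real_of_ereal y)). hitting_time 0 (\<lambda>_. x) w \<le> ereal u})
            \<longlongrightarrow> 0) (at_right r1)"
    and natural_right:
      "\<And>x u. x \<in> einterval r1 r2 \<Longrightarrow>
         ((\<lambda>y. measure (Q (real_of_ereal y))
                 {w \<in> space (Q (real_of_ereal y)). hitting_time 0 (\<lambda>_. x) w \<le> ereal u})
            \<longlongrightarrow> 0) (at_left r2)"

text \<open>\<open>X\<close> is such a diffusion on \<open>[t\<^sub>0, \<infinity>)\<close> started from \<open>x\<^sub>0\<close>. That \<open>X t\<^sub>0 = x\<^sub>0\<close> almost surely and
  the strong Markov property of \<open>X\<close> are contained in \<open>law\<close>.\<close>

locale diffusion_process = diffusion_family r1 r2 Q + prob_space M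
  for r1 r2 :: ereal and Q :: "real \<Rightarrow> (real \<Rightarrow> real) measure"
    and M :: "'a measure" and t0 x0 :: real and X :: "real \<Rightarrow> 'a \<Rightarrow> real" +
  assumes x0_in: "x0 \<in> einterval r1 r2"
    and measurable_X: "\<And>t. t0 \<le> t \<Longrightarrow> X t \<in> borel_measurable M"
    and X_in: "\<And>\<omega> t. \<omega> \<in> space M \<Longrightarrow> t0 \<le> t \<Longrightarrow> X t \<omega> \<in> einterval r1 r2"
    and continuous_X: "\<And>\<omega>. \<omega> \<in> space M \<Longrightarrow> continuous_on {t0..} (\<lambda>t. X t \<omega>)"
    and law: "distr M (path_space (einterval r1 r2)) (\<lambda>\<omega>. \<lambda>u\<in>{0..}. X (t0 + u) \<omega>) = Q x0"

definition boundary :: "real set \<Rightarrow> real \<Rightarrow> (real \<Rightarrow> real) \<Rightarrow> bool" where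
  "boundary I t0 c \<longleftrightarrow>
     (\<forall>t\<ge>t0. c t \<in> I) \<and> continuous_on {t0..} c \<and>
     (\<exists>c'. (\<forall>t\<ge>t0. (c has_real_derivative c' t) (at t within {t0..})) \<and> bounded (c' ` {t0..}))"

section \<open>Densities\<close>

text \<open>All times may be infinite with positive probability, so densities are in general
  sub-probability densities; they are determined by the distribution functions at finite times.

  \<open>f\<close> is the density of \<open>T\<close> on the event \<open>E\<close>, i.e. \<open>f(t) dt = P(T \<in> dt, E)\<close> for \<open>t > \<tau>\<close>
  (with \<open>P(T \<le> \<tau>, E) = 0\<close>).\<close>

definition density_on ::
  "'a measure \<Rightarrow> real \<Rightarrow> ('a \<Rightarrow> ereal) \<Rightarrow> ('a \<Rightarrow> bool) \<Rightarrow> (real \<Rightarrow> ennreal) \<Rightarrow> bool" where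
  "density_on M \<tau> T E f \<longleftrightarrow>
     f \<in> borel_measurable (restrict_space borel {\<tau><..}) \<and>
     (\<forall>t\<ge>\<tau>. emeasure M {\<omega> \<in> space M. T \<omega> \<le> ereal t \<and> E \<omega>} = (\<integral>\<^sup>+u\<in>{\<tau><..t}. f u \<partial>lborel))"

definition joint_density_of ::
  "'a measure \<Rightarrow> real \<Rightarrow> ('a \<Rightarrow> ereal) \<Rightarrow> ('a \<Rightarrow> ereal) \<Rightarrow> (real \<Rightarrow> real \<Rightarrow> ennreal) \<Rightarrow> bool" where
  "joint_density_of M \<tau> T S f \<longleftrightarrow>
     (\<lambda>(t, s). f t s) \<in> borel_measurable (restrict_space borel ({\<tau><..} \<times> {\<tau><..})) \<and>
     (\<forall>t\<ge>\<tau>. \<forall>s\<ge>\<tau>.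
        emeasure M {\<omega> \<in> space M. T \<omega> \<le> ereal t \<and> S \<omega> \<le> ereal s}
          = (\<integral>\<^sup>+(u, v)\<in>{\<tau><..t} \<times> {\<tau><..s}. f u v \<partial>(lborel \<Otimes>\<^sub>M lborel)))"

text \<open>\<open>f s y \<tau>\<close> is the density at \<open>s > \<tau>\<close> of the first hitting time of \<open>c\<close> by the process started from
  \<open>y\<close> at time \<open>\<tau>\<close>. If \<open>y = c \<tau>\<close> the hitting time is \<open>\<tau>\<close> and has no density, so this case is left
  out. Densities are only determined almost everywhere in \<open>s\<close>; as usual the version is chosen
  measurable in all arguments together.\<close>

definition hitting_densities ::
  "(real \<Rightarrow> (real \<Rightarrow> real) measure) \<Rightarrow> real set \<Rightarrow> real \<Rightarrow> (real \<Rightarrow> real)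
     \<Rightarrow> (real \<Rightarrow> real \<Rightarrow> real \<Rightarrow> ennreal) \<Rightarrow> bool" where
  "hitting_densities Q I t0 c f \<longleftrightarrow>
     (\<lambda>(s, y, \<tau>). f s y \<tau>) \<in> borel_measurable
        (restrict_space borel {(s, y, \<tau>). t0 \<le> \<tau> \<and> \<tau> < s \<and> y \<in> I \<and> y \<noteq> c \<tau>}) \<and>
     (\<forall>\<tau>\<ge>t0. \<forall>y\<in>I. y \<noteq> c \<tau> \<longrightarrow>
        density_on (Q y) \<tau> (\<lambda>w. hitting_time \<tau> c (\<lambda>t. w (t - \<tau>))) (\<lambda>_. True) (\<lambda>s. f s y \<tau>))"

end

theory Submission
  imports Defs
begin

text \<open>Let \<open>c\<close> be the boundary hit first, at time \<open>T\<close>, and \<open>d\<close> the other one. On the event that \<open>c\<close> is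
  hit before \<open>d\<close>, the hitting time of \<open>d\<close> is a function of \<open>T\<close> and of the path after \<open>T\<close>, namely the
  hitting time of \<open>d\<close> by the process that starts from \<open>c T\<close> at time \<open>T\<close>. A monotone class argument
  extends the strong Markov property to events that depend jointly on \<open>T\<close> and on the shifted path, so
  conditioning on \<open>T\<close> gives \<open>P(T \<le> t, T\<^sub>d \<le> s, T < T\<^sub>d)\<close> as the integral of
  \<open>g u * f\<^sub>d(v | c u, u)\<close> over \<open>u \<le> t\<close>, \<open>u < v \<le> s\<close>, where \<open>g\<close> is the density of \<open>T\<close> on
  \<open>T < T\<^sub>d\<close>. In (i) the nearer boundary is necessarily hit first, by the intermediate value theorem,
  so that \<open>g\<close> is the density of \<open>T\<close>; in (ii) the formula is applied to both orders.\<close>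

section \<open>Hitting times and path space\<close>

text \<open>The meeting times form a closed set bounded below by \<tau>, being the zeros of the
  continuous function \<open>Y - c\<close> on \<open>{\<tau>..}\<close>. So the infimum is attained
  when the set is nonempty, and is \<infinity> otherwise.\<close>

lemma hitting_time_cases:
  assumes "continuous_on {\<tau>..} c" "continuous_on {\<tau>..} Y"
  obtains (never) "hitting_time \<tau> c Y = \<infinity>" "\<And>t. \<tau> \<le> t \<Longrightarrow> Y t \<noteq> c t"
  | (hit) t where "hitting_time \<tau> c Y = ereal t" "\<tau> \<le> t" "Y t = c t"
      "\<And>r. \<tau> \<le> r \<Longrightarrow> r < t \<Longrightarrow> Y r \<noteq> c r"
proof -
  define S where "S = {t \<in> {\<tau>..}. Y t = c t}"
  have ht: "hitting_time \<tau> c Y = Inf (ereal ` S)"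
    unfolding hitting_time_def S_def by (rule arg_cong[where f = Inf]) auto
  show ?thesis
  proof (cases "S = {}")
    case True
    with ht have "hitting_time \<tau> c Y = \<infinity>"
      by (simp add: top_ereal_def)
    with True show ?thesis
      by (intro never) (auto simp: S_def)
  next
    case False
    have "closed S"
    proof -
      have "closed {t \<in> {\<tau>..}. Y t - c t = 0}"
        using assms by (intro continuous_closed_preimage_constant continuous_on_diff) auto
      then show ?thesis
        by (simp add: S_def)
    qed
    have bdd: "bdd_below S"
      by (auto simp: S_def intro!: bdd_belowI[where m = \<tau>])
    have "Inf S \<in> S"
      by (rule closed_contains_Inf) fact+
    moreover have "Inf S \<le> r" if "r \<in> S" for r
      using that bdd by (rule cInf_lower)
    ultimately have "hitting_time \<tau> c Y = ereal (Inf S)"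
      unfolding ht by (intro antisym Inf_lower Inf_greatest) auto
    with \<open>Inf S \<in> S\<close> show ?thesis
      using cInf_lower[OF _ bdd] by (intro hit[of "Inf S"]) (force simp: S_def)+
  qed
qed

lemma hitting_time_le_iff:
  assumes "continuous_on {\<tau>..} c" "continuous_on {\<tau>..} Y"
  shows "hitting_time \<tau> c Y \<le> ereal s \<longleftrightarrow> (\<exists>t. \<tau> \<le> t \<and> t \<le> s \<and> Y t = c t)"
  using assms
proof (cases rule: hitting_time_cases)
  case never
  then show ?thesis by auto
next
  case (hit t)
  have "t \<le> s" if "\<tau> \<le> r" "r \<le> s" "Y r = c r" for r
    using hit(4)[of r] that by force
  with hit(1-3) show ?thesis by auto
qed

text \<open>This trades an uncountable existential for countable quantifiers, so that hitting events
  become measurable through the coordinates. The map \<open>min \<bar>q\<bar> L\<close> folds every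
  rational into \<open>{0..L}\<close>: nothing after \<open>L\<close> is sampled, and
  \<open>L\<close> itself is sampled even when it is irrational.\<close>

lemma ex_zero_iff_rational:
  fixes \<phi> :: "real \<Rightarrow> real"
  assumes "continuous_on {0..} \<phi>"
  shows "(\<exists>r\<in>{0..L}. \<phi> r = 0) \<longleftrightarrow>
    0 \<le> L \<and> (\<forall>n. \<exists>q::rat. \<bar>\<phi> (min \<bar>of_rat q\<bar> L)\<bar> < inverse (real (Suc n)))"
proof safe
  fix r n assume r: "r \<in> {0..L}" "\<phi> r = 0"
  then show "0 \<le> L" by simp
  \<comment> \<open>Folding keeps the sampled function continuous on the whole line, so any rational
    close to the zero \<open>r\<close> makes it small, also when \<open>r = L\<close>.\<close>
  have "continuous_on UNIV (\<lambda>x. \<bar>\<phi> (min \<bar>x\<bar> L)\<bar>)"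
    using r by (intro continuous_intros continuous_on_compose2[OF assms]) auto
  then have "open ((\<lambda>x. \<bar>\<phi> (min \<bar>x\<bar> L)\<bar>) -` {..<inverse (real (Suc n))})"
    by (intro open_vimage) auto
  moreover have "r \<in> (\<lambda>x. \<bar>\<phi> (min \<bar>x\<bar> L)\<bar>) -` {..<inverse (real (Suc n))}"
    using r by (auto simp: min_absorb1)
  ultimately have "\<exists>e>0. \<forall>x. dist x r < e \<longrightarrow> x \<in> (\<lambda>x. \<bar>\<phi> (min \<bar>x\<bar> L)\<bar>) -` {..<inverse (real (Suc n))}"
    unfolding open_dist by blast
  then obtain e where e: "e > 0"
    "\<And>x. dist x r < e \<Longrightarrow> \<bar>\<phi> (min \<bar>x\<bar> L)\<bar> < inverse (real (Suc n))"
    unfolding vimage_def lessThan_def by blast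
  obtain q where "r < of_rat q" "of_rat q < r + e"
    using of_rat_dense[of r "r + e"] e(1) by auto
  then have "\<bar>\<phi> (min \<bar>of_rat q\<bar> L)\<bar> < inverse (real (Suc n))"
    by (intro e) (auto simp: dist_real_def)
  then show "\<exists>q::rat. \<bar>\<phi> (min \<bar>of_rat q\<bar> L)\<bar> < inverse (real (Suc n))" ..
next
  assume L: "0 \<le> L" and *: "\<forall>n. \<exists>q::rat. \<bar>\<phi> (min \<bar>of_rat q\<bar> L)\<bar> < inverse (real (Suc n))"
  \<comment> \<open>Conversely, \<bar>\<phi>\<bar> attains its minimum on the compact interval; a
    positive minimum would exceed some \<open>inverse (real (Suc n))\<close> and contradict the
    sampled values.\<close>
  have "continuous_on {0..L} (\<lambda>r. \<bar>\<phi> r\<bar>)"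
    by (intro continuous_on_rabs continuous_on_subset[OF assms]) auto
  then have "\<exists>r\<in>{0..L}. \<forall>y\<in>{0..L}. \<bar>\<phi> r\<bar> \<le> \<bar>\<phi> y\<bar>"
    using L by (intro continuous_attains_inf) auto
  then obtain r where r: "r \<in> {0..L}" "\<And>y. y \<in> {0..L} \<Longrightarrow> \<bar>\<phi> r\<bar> \<le> \<bar>\<phi> y\<bar>"
    by auto
  have "\<phi> r = 0"
  proof (rule ccontr)
    assume "\<phi> r \<noteq> 0"
    then have "0 < \<bar>\<phi> r\<bar>"
      by simp
    then obtain n where n: "inverse (real (Suc n)) < \<bar>\<phi> r\<bar>"
      using reals_Archimedean by blast
    obtain q where "\<bar>\<phi> (min \<bar>of_rat q\<bar> L)\<bar> < inverse (real (Suc n))"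
      using * by blast
    moreover have "\<bar>\<phi> r\<bar> \<le> \<bar>\<phi> (min \<bar>of_rat q\<bar> L)\<bar>"
      using L by (intro r(2)) auto
    ultimately show False using n by simp
  qed
  with r show "\<exists>r\<in>{0..L}. \<phi> r = 0" by blast
qed

section \<open>Evaluation and shift of paths at random times\<close>

lemma space_path_space:
  "space (path_space I) = {w \<in> extensional {0..}. continuous_on {0..} w \<and> w ` {0..} \<subseteq> I}"
  unfolding path_space_def space_restrict_space space_PiM by (auto simp: PiE_def)

lemma path_space_coordinate_measurable:
  "0 \<le> r \<Longrightarrow> (\<lambda>w. w r) \<in> borel_measurable (path_space I)"
  unfolding path_space_def by (intro measurable_restrict_space1 measurable_component_singleton) auto

lemma measurable_path_spaceI:
  assumes "\<And>r. 0 \<le> r \<Longrightarrow> (\<lambda>x. h x r) \<in> borel_measurable N"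
    and "\<And>x. x \<in> space N \<Longrightarrow> h x \<in> space (path_space I)"
  shows "h \<in> N \<rightarrow>\<^sub>M path_space I"
proof -
  have "h \<in> N \<rightarrow>\<^sub>M PiM {0..} (\<lambda>_. borel)"
  proof (rule measurable_PiM_single')
    show "(\<lambda>x. h x r) \<in> borel_measurable N" if "r \<in> {0..}" for r
      using that assms(1) by auto
    show "h \<in> space N \<rightarrow> ({0..} \<rightarrow>\<^sub>E space borel)"
      using assms(2) by (auto simp: space_path_space PiE_def)
  qed
  then show ?thesis
    using assms(2) unfolding path_space_def
    by (intro measurable_restrict_space2) (auto simp: space_path_space path_space_def[symmetric])
qed

text \<open>The random time is approximated by the grid points
  \<open>\<lfloor>f x * (n + 1)\<rfloor> / (n + 1)\<close>. At a grid time the evaluation is a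
  countable case distinction among coordinate maps, and continuity of the path carries measurability
  to the limit.\<close>

lemma measurable_path_eval:
  assumes f: "f \<in> borel_measurable N" and g: "g \<in> N \<rightarrow>\<^sub>M path_space I"
    and nonneg: "\<And>x. x \<in> space N \<Longrightarrow> 0 \<le> f x"
  shows "(\<lambda>x. g x (f x)) \<in> borel_measurable N"
proof (rule borel_measurable_LIMSEQ_real)
  fix n
  show "(\<lambda>x. g x (real (nat \<lfloor>f x * real (Suc n)\<rfloor>) / real (Suc n))) \<in> borel_measurable N"
  proof (rule measurable_compose_countable[where f = "\<lambda>i x. g x (real i / real (Suc n))"])
    show "(\<lambda>x. g x (real i / real (Suc n))) \<in> borel_measurable N" for i
      by (rule measurable_compose[OF g path_space_coordinate_measurable]) simp
    show "(\<lambda>x. nat \<lfloor>f x * real (Suc n)\<rfloor>) \<in> N \<rightarrow>\<^sub>M count_space UNIV"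
      using f by measurable
  qed
next
  fix x assume x: "x \<in> space N"
  have cont: "continuous_on {0..} (g x)"
    using measurable_space[OF g x] by (simp add: space_path_space)
  have "(\<lambda>n. real_of_int \<lfloor>f x * real (Suc n)\<rfloor> / real (Suc n)) \<longlonglongrightarrow> f x"
  proof (rule tendsto_sandwich)
    have "f x - 1 / real (Suc n) \<le> real_of_int \<lfloor>f x * real (Suc n)\<rfloor> / real (Suc n)" for n
    proof -
      have "f x * real (Suc n) - 1 \<le> real_of_int \<lfloor>f x * real (Suc n)\<rfloor>"
        by linarith
      then have "(f x * real (Suc n) - 1) / real (Suc n) \<le> real_of_int \<lfloor>f x * real (Suc n)\<rfloor> / real (Suc n)"
        by (rule divide_right_mono) simp
      then show ?thesis
        by (simp add: diff_divide_distrib del: of_nat_Suc)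
    qed
    then show "\<forall>\<^sub>F n in sequentially.
        f x - 1 / real (Suc n) \<le> real_of_int \<lfloor>f x * real (Suc n)\<rfloor> / real (Suc n)"
      by (intro always_eventually) blast
    have "real_of_int \<lfloor>f x * real (Suc n)\<rfloor> / real (Suc n) \<le> f x" for n
      using floor_correct[of "f x * real (Suc n)"] by (simp add: field_simps del: of_nat_Suc)
    then show "\<forall>\<^sub>F n in sequentially. real_of_int \<lfloor>f x * real (Suc n)\<rfloor> / real (Suc n) \<le> f x"
      by (intro always_eventually) blast
    have "(\<lambda>n. f x - 1 / real (Suc n)) \<longlonglongrightarrow> f x - 0"
      by (intro tendsto_diff tendsto_const) (use LIMSEQ_inverse_real_of_nat in \<open>simp add: inverse_eq_divide\<close>)
    then show "(\<lambda>n. f x - 1 / real (Suc n)) \<longlonglongrightarrow> f x" by simp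
  qed auto
  then have "(\<lambda>n. real (nat \<lfloor>f x * real (Suc n)\<rfloor>) / real (Suc n)) \<longlonglongrightarrow> f x"
    using nonneg[OF x] by (simp add: of_nat_nat)
  then show "(\<lambda>n. g x (real (nat \<lfloor>f x * real (Suc n)\<rfloor>) / real (Suc n))) \<longlonglongrightarrow> g x (f x)"
    using nonneg[OF x] by (intro continuous_on_tendsto_compose[OF cont]) auto
qed

lemma path_shift_in_space:
  assumes "w \<in> space (path_space I)" "0 \<le> u"
  shows "path_shift u w \<in> space (path_space I)"
proof -
  have "continuous_on {0..} w"
    using assms by (simp add: space_path_space)
  moreover have "continuous_on {0..} (\<lambda>r. u + r)"
    by (intro continuous_intros)
  ultimately have "continuous_on {0..} (\<lambda>r. w (u + r))"
    by (rule continuous_on_compose2) (use assms in auto)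
  then have "continuous_on {0..} (path_shift u w)"
    by (subst continuous_on_cong[OF refl, where g = "\<lambda>r. w (u + r)"]) (auto simp: path_shift_def)
  then show ?thesis
    using assms by (auto simp: space_path_space path_shift_def image_subset_iff)
qed

text \<open>Measurability into path space is tested coordinatewise, and the coordinate
  \<open>r\<close> of the shifted path is an evaluation at the random time
  \<open>f x + r\<close>.\<close>

lemma measurable_path_shift:
  assumes f: "f \<in> borel_measurable N" and g: "g \<in> N \<rightarrow>\<^sub>M path_space I"
    and nonneg: "\<And>x. x \<in> space N \<Longrightarrow> 0 \<le> f x"
  shows "(\<lambda>x. path_shift (f x) (g x)) \<in> N \<rightarrow>\<^sub>M path_space I"
proof (rule measurable_path_spaceI)
  fix r :: real assume "0 \<le> r"
  then have "(\<lambda>x. g x (f x + r)) \<in> borel_measurable N"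
    using f g nonneg by (intro measurable_path_eval[where g = g]) auto
  then show "(\<lambda>x. path_shift (f x) (g x) r) \<in> borel_measurable N"
    using \<open>0 \<le> r\<close> by (simp add: path_shift_def)
qed (use nonneg measurable_space[OF g] in \<open>auto intro: path_shift_in_space\<close>)

section \<open>The natural filtration\<close>

lemma space_path_filtration: "space (path_filtration I u) = space (path_space I)"
  unfolding path_filtration_def by (rule space_measure_of) auto

lemma filtration_path_filtration: "filtration (space (path_space I)) (path_filtration I)"
proof
  fix i j :: real assume "i \<le> j"
  then show "sets (path_filtration I i) \<subseteq> sets (path_filtration I j)"
    unfolding path_filtration_def
    by (subst (1 2) sets_measure_of) (auto intro!: sigma_sets_mono' dest: order_trans[OF _ \<open>i \<le> j\<close>])
qed (rule space_path_filtration)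

lemma sets_path_filtration: "sets (path_filtration I u) \<subseteq> sets (path_space I)"
proof -
  have "{w \<in> space (path_space I). w r \<in> B} \<in> sets (path_space I)"
    if "0 \<le> r" "B \<in> sets borel" for r B
    using measurable_sets[OF path_space_coordinate_measurable[OF that(1)] that(2), of I]
    by (auto simp: vimage_def Int_def conj_commute)
  then show ?thesis
    unfolding path_filtration_def
    by (subst sets_measure_of) (auto intro!: sets.sigma_sets_subset)
qed

lemma path_filtration_coordinate_measurable:
  assumes "0 \<le> r" "r \<le> u"
  shows "(\<lambda>w. w r) \<in> borel_measurable (path_filtration I u)"
proof (rule measurableI)
  fix B :: "real set" assume "B \<in> sets borel"
  then have "{w \<in> space (path_space I). w r \<in> B} \<in> sets (path_filtration I u)"
    unfolding path_filtration_def using assms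
    by (subst sets_measure_of) (auto intro!: sigma_sets.Basic)
  then show "(\<lambda>w. w r) -` B \<inter> space (path_filtration I u) \<in> sets (path_filtration I u)"
    by (simp add: space_path_filtration vimage_def Int_def conj_commute)
qed simp

section \<open>Measurability of hitting events\<close>

lemma continuous_on_shifted_path:
  assumes "w \<in> space (path_space I)"
  shows "continuous_on {\<tau>..} (\<lambda>t. w (t - \<tau>))"
proof -
  have "continuous_on {0..} w"
    using assms by (simp add: space_path_space)
  moreover have "continuous_on {\<tau>..} (\<lambda>t. t - \<tau>)"
    by (intro continuous_intros)
  ultimately show ?thesis
    by (rule continuous_on_compose2) auto
qed

lemma path_hitting_time_le_iff:
  assumes c: "continuous_on {\<tau>..} c" and w: "w \<in> space (path_space I)"
  shows "hitting_time \<tau> c (\<lambda>t. w (t - \<tau>)) \<le> ereal s \<longleftrightarrow> (\<exists>r\<in>{0..s - \<tau>}. w r - c (\<tau> + r) = 0)"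
proof -
  have "(\<exists>t. \<tau> \<le> t \<and> t \<le> s \<and> w (t - \<tau>) = c t) \<longleftrightarrow> (\<exists>r\<in>{0..s - \<tau>}. w r - c (\<tau> + r) = 0)"
    (is "?L = ?R")
  proof
    assume ?L
    then obtain t where "\<tau> \<le> t" "t \<le> s" "w (t - \<tau>) = c t" by auto
    then show ?R by (intro bexI[of _ "t - \<tau>"]) auto
  next
    assume ?R
    then obtain r where "0 \<le> r" "r \<le> s - \<tau>" "w r = c (\<tau> + r)" by auto
    then show ?L by (intro exI[of _ "\<tau> + r"]) auto
  qed
  then show ?thesis
    using hitting_time_le_iff[OF c continuous_on_shifted_path[OF w]] by simp
qed

text \<open>The path is sampled only at times up to \<open>s - \<tau>\<close>, because the filtration is not right-continuous.\<close>

lemma path_hitting_time_le_iff_rational: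
  assumes c: "continuous_on {\<tau>..} c" and w: "w \<in> space (path_space I)"
  shows "hitting_time \<tau> c (\<lambda>t. w (t - \<tau>)) \<le> ereal s \<longleftrightarrow> 0 \<le> s - \<tau> \<and>
    (\<forall>n. \<exists>q::rat. \<bar>w (min \<bar>of_rat q\<bar> (s - \<tau>)) - c (\<tau> + min \<bar>of_rat q\<bar> (s - \<tau>))\<bar>
      < inverse (real (Suc n)))"
proof -
  have "continuous_on {0..} (\<lambda>r. \<tau> + r)"
    by (intro continuous_intros)
  with c have "continuous_on {0..} (\<lambda>r. c (\<tau> + r))"
    by (rule continuous_on_compose2) auto
  with w have "continuous_on {0..} (\<lambda>r. w r - c (\<tau> + r))"
    by (intro continuous_on_diff) (simp_all add: space_path_space)
  then show ?thesis
    unfolding path_hitting_time_le_iff[OF assms] by (rule ex_zero_iff_rational)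
qed

text \<open>With \<open>s = \<tau> + u\<close> the rational criterion reads the path only at times
  in \<open>{0..u}\<close>, so the event is known at time \<open>u\<close>. For negative
  \<open>u\<close> it is empty. This is what makes hitting times stopping times of the natural
  filtration.\<close>

lemma pred_path_hitting_time_le_filtration:
  assumes c: "continuous_on {\<tau>..} c"
  shows "Measurable.pred (path_filtration I u) (\<lambda>w. hitting_time \<tau> c (\<lambda>t. w (t - \<tau>)) \<le> ereal (\<tau> + u))"
proof (cases "0 \<le> u")
  case True
  have [measurable]: "(\<lambda>w. w (min \<bar>real_of_rat q\<bar> u)) \<in> borel_measurable (path_filtration I u)" for q
    using True by (intro path_filtration_coordinate_measurable) auto
  have "Measurable.pred (path_filtration I u) (\<lambda>w. \<forall>n. \<exists>q::rat.
    \<bar>w (min \<bar>of_rat q\<bar> u) - c (\<tau> + min \<bar>of_rat q\<bar> u)\<bar> < inverse (real (Suc n)))"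
    by measurable
  also have "?this \<longleftrightarrow> ?thesis"
    using True by (intro measurable_cong)
      (simp add: space_path_filtration path_hitting_time_le_iff_rational[OF c])
  finally show ?thesis .
next
  case False
  then have "Measurable.pred (path_filtration I u) (\<lambda>_. False) \<longleftrightarrow> ?thesis"
    by (intro measurable_cong)
      (simp add: space_path_filtration path_hitting_time_le_iff_rational[OF c])
  then show ?thesis by simp
qed

text \<open>Here the starting time \<open>t0 + u\<close> varies together with the path. The
  resulting set of pairs is the one to which the strong Markov property is applied later, with
  \<open>u\<close> the time already elapsed.\<close>

lemma pred_path_hitting_time_le_joint:
  assumes c: "continuous_on {t0..} c"
  shows "Measurable.pred (borel \<Otimes>\<^sub>M path_space I)
    (\<lambda>(u::real, w). 0 \<le> u \<and> hitting_time (t0 + u) c (\<lambda>t. w (t - (t0 + u))) \<le> ereal s)"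
proof -
  \<comment> \<open>Continuity of \<open>c\<close> is known only on \<open>{t0..}\<close>; freezing
    its value to the left of \<open>t0\<close> gives a Borel function on the whole line.\<close>
  define c' where "c' t = c (max t0 t)" for t
  have "continuous_on UNIV c'"
    unfolding c'_def by (intro continuous_on_compose2[OF c] continuous_intros) auto
  then have [measurable]: "c' \<in> borel_measurable borel"
    by (rule borel_measurable_continuous_onI)
  \<comment> \<open>The outer \<open>max 0\<close> keeps the sampling time nonnegative also when
    \<open>s < t0 + u\<close>, where the remaining time is negative and the event is empty.\<close>
  define \<rho> where "\<rho> q u = max 0 (min \<bar>real_of_rat q\<bar> (s - (t0 + u)))" for q u
  have [measurable]: "\<rho> q \<in> borel_measurable borel" for q
    unfolding \<rho>_def by measurable
  have [measurable]: "(\<lambda>x. snd x (\<rho> q (fst x))) \<in> borel_measurable (borel \<Otimes>\<^sub>M path_space I)" for q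
    by (rule measurable_path_eval[where I = I]) (measurable, simp add: \<rho>_def)
  have "Measurable.pred (borel \<Otimes>\<^sub>M path_space I) (\<lambda>x. (0::real) \<le> fst x \<and> 0 \<le> s - (t0 + fst x) \<and>
    (\<forall>n. \<exists>q::rat. \<bar>snd x (\<rho> q (fst x)) - c' (t0 + fst x + \<rho> q (fst x))\<bar> < inverse (real (Suc n))))"
    by measurable
  also have "?this \<longleftrightarrow> ?thesis"
  proof (rule measurable_cong)
    fix x :: "real \<times> (real \<Rightarrow> real)" assume "x \<in> space (borel \<Otimes>\<^sub>M path_space I)"
    then obtain u w where x: "x = (u, w)" and w: "w \<in> space (path_space I)"
      by (cases x) (auto simp: space_pair_measure)
    show "(0 \<le> fst x \<and> 0 \<le> s - (t0 + fst x) \<and>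
        (\<forall>n. \<exists>q::rat. \<bar>snd x (\<rho> q (fst x)) - c' (t0 + fst x + \<rho> q (fst x))\<bar> < inverse (real (Suc n))))
      = (case x of (u, w) \<Rightarrow> 0 \<le> u \<and> hitting_time (t0 + u) c (\<lambda>t. w (t - (t0 + u))) \<le> ereal s)"
    proof (cases "0 \<le> u \<and> 0 \<le> s - (t0 + u)")
      case True
      from c have "continuous_on {t0 + u..} c"
        by (rule continuous_on_subset) (use True in auto)
      moreover have "\<rho> q u = min \<bar>real_of_rat q\<bar> (s - (t0 + u))"
        "c' (t0 + u + \<rho> q u) = c (t0 + u + \<rho> q u)" for q
        using True by (auto simp: \<rho>_def c'_def)
      ultimately show ?thesis
        using True by (simp add: x path_hitting_time_le_iff_rational[OF _ w])
    next
      case False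
      moreover have "continuous_on {t0 + u..} c" if "0 \<le> u"
        by (rule continuous_on_subset[OF c]) (use that in auto)
      ultimately show ?thesis
        by (auto simp: x path_hitting_time_le_iff_rational[OF _ w])
    qed
  qed
  finally show ?thesis .
qed

text \<open>\<open>density_on\<close> prescribes only a distribution function. The law of
  \<open>T\<close> on the event \<open>A\<close> and the measure with density \<open>g\<close> on
  \<open>{\<tau><..t}\<close> have the same distribution function, hence are equal, and integrals of
  \<open>h\<close> can be transferred. On \<open>A\<close> the time is finite, because it lies
  between \<tau> and \<open>t\<close>.\<close>

lemma nn_integral_density_on:
  fixes h :: "real \<Rightarrow> ennreal"
  assumes "finite_measure M" and dens: "density_on M \<tau> T E g"
    and sets: "\<And>t. {\<omega> \<in> space M. T \<omega> \<le> ereal t \<and> E \<omega>} \<in> sets M"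
    and ge: "\<And>\<omega>. \<omega> \<in> space M \<Longrightarrow> ereal \<tau> \<le> T \<omega>"
    and t: "\<tau> \<le> t" and h: "h \<in> borel_measurable borel"
  shows "(\<integral>\<^sup>+\<omega>\<in>{\<omega> \<in> space M. T \<omega> \<le> ereal t \<and> E \<omega>}. h (real_of_ereal (T \<omega>)) \<partial>M)
    = (\<integral>\<^sup>+u\<in>{\<tau><..t}. h u * g u \<partial>lborel)"
proof -
  interpret finite_measure M by fact
  define A where "A = {\<omega> \<in> space M. T \<omega> \<le> ereal t \<and> E \<omega>}"
  have A: "A \<in> sets M"
    unfolding A_def by (rule sets)
  define S where "S = (\<lambda>\<omega>. real_of_ereal (T \<omega>))"
  have S: "T \<omega> = ereal (S \<omega>)" if "\<omega> \<in> A" for \<omega>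
    using that ge[of \<omega>] unfolding S_def A_def by (cases "T \<omega>") auto
  have space_A: "space (restrict_space M A) = A"
    using sets.sets_into_space[OF A] by (auto simp: space_restrict_space)
  \<comment> \<open>Inside \<open>A\<close> a bound \<open>x\<close> beyond \<open>t\<close> adds
    nothing, so every sublevel set is one of the events covered by \<open>sets\<close>.\<close>
  have le_iff: "{\<omega> \<in> A. S \<omega> \<le> x} = {\<omega> \<in> space M. T \<omega> \<le> ereal (min x t) \<and> E \<omega>}" for x
  proof -
    have "S \<omega> \<le> x \<longleftrightarrow> T \<omega> \<le> ereal x" if "\<omega> \<in> A" for \<omega>
      using S[OF that] by simp
    then have "{\<omega> \<in> A. S \<omega> \<le> x} = {\<omega> \<in> A. T \<omega> \<le> ereal x}"
      by blast
    also have "\<dots> = {\<omega> \<in> space M. T \<omega> \<le> ereal (min x t) \<and> E \<omega>}"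
      by (auto simp: A_def ereal_min)
    finally show ?thesis .
  qed
  have S_meas: "S \<in> borel_measurable (restrict_space M A)"
  proof (rule borel_measurableI_le)
    fix x
    have "{\<omega> \<in> A. S \<omega> \<le> x} \<in> sets M"
      unfolding le_iff by (rule sets)
    then show "{\<omega> \<in> space (restrict_space M A). S \<omega> \<le> x} \<in> sets (restrict_space M A)"
      using A by (subst sets_restrict_space_iff) (auto simp: space_A)
  qed
  \<comment> \<open>\<open>g\<close> is measurable only on \<open>{\<tau><..}\<close>; its extension
    by 0 is Borel on the line.\<close>
  define k where "k u = (if u \<in> {\<tau><..} then g u else 0)" for u
  have k [measurable]: "k \<in> borel_measurable borel"
    using dens unfolding density_on_def k_def by (subst measurable_restrict_space_iff[symmetric]) auto
  define \<mu> where "\<mu> = distr (restrict_space M A) borel S"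
  define \<nu> where "\<nu> = density lborel (\<lambda>u. k u * indicator {\<tau><..t} u)"
  have \<mu>: "emeasure \<mu> {..x} = emeasure M {\<omega> \<in> space M. T \<omega> \<le> ereal (min x t) \<and> E \<omega>}" for x
  proof -
    have "emeasure \<mu> {..x} = emeasure (restrict_space M A) (S -` {..x} \<inter> A)"
      unfolding \<mu>_def using S_meas by (simp add: emeasure_distr space_A)
    also have "S -` {..x} \<inter> A = {\<omega> \<in> A. S \<omega> \<le> x}"
      by auto
    also have "emeasure (restrict_space M A) \<dots> = emeasure M \<dots>"
      using A by (intro emeasure_restrict_space) auto
    finally show ?thesis
      unfolding le_iff .
  qed
  have \<nu>: "emeasure \<nu> {..x} = (\<integral>\<^sup>+u\<in>{\<tau><..min x t}. g u \<partial>lborel)" for x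
  proof -
    have "emeasure \<nu> {..x} = (\<integral>\<^sup>+u. k u * indicator {\<tau><..t} u * indicator {..x} u \<partial>lborel)"
      unfolding \<nu>_def by (rule emeasure_density) measurable
    also have "\<dots> = (\<integral>\<^sup>+u\<in>{\<tau><..min x t}. g u \<partial>lborel)"
      by (intro nn_integral_cong) (auto simp: k_def split: split_indicator)
    finally show ?thesis .
  qed
  have eq: "emeasure \<mu> {..x} = emeasure \<nu> {..x}" for x
  proof (cases "\<tau> \<le> x")
    case True
    with t dens show ?thesis
      unfolding \<mu> \<nu> density_on_def by (simp add: min_def)
  next
    case False
    then have min: "min x t = x" and "{\<tau><..x} = {}"
      using t by auto
    moreover have "{\<omega> \<in> space M. T \<omega> \<le> ereal x \<and> E \<omega>} = {}"
      using ge False by (fastforce dest: order_trans)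
    ultimately show ?thesis
      unfolding \<mu> \<nu> min by (simp only: emeasure_empty indicator_simps mult_zero_right nn_integral_const empty_iff) simp
  qed
  \<comment> \<open>Uniqueness from the distribution function is used for finite measures; the total
    mass of \<nu> is that of \<open>A\<close>.\<close>
  have fin: "emeasure \<nu> UNIV \<noteq> \<infinity>"
  proof -
    have "emeasure \<nu> UNIV = (\<integral>\<^sup>+u. k u * indicator {\<tau><..t} u * indicator UNIV u \<partial>lborel)"
      unfolding \<nu>_def by (rule emeasure_density) measurable
    also have "\<dots> = (\<integral>\<^sup>+u\<in>{\<tau><..t}. g u \<partial>lborel)"
      by (intro nn_integral_cong) (auto simp: k_def split: split_indicator)
    also have "\<dots> = emeasure M A"
      using dens t unfolding A_def density_on_def by simp
    finally show ?thesis by simp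
  qed
  have "\<mu> = \<nu>"
  proof (rule cdf_unique')
    show "finite_borel_measure \<mu>"
      unfolding \<mu>_def using S_meas A
      by (intro finite_borel_measure.intro finite_borel_measure_axioms.intro finite_measure.finite_measure_distr
          finite_measure_restrict_space) (auto simp: finite_measure_axioms)
    show "finite_borel_measure \<nu>"
      using fin by (intro finite_borel_measure.intro finite_borel_measure_axioms.intro finite_measureI)
        (auto simp: \<nu>_def)
    show "cdf \<mu> = cdf \<nu>"
      using eq by (simp add: cdf_def measure_def)
  qed
  have "(\<integral>\<^sup>+\<omega>\<in>A. h (S \<omega>) \<partial>M) = (\<integral>\<^sup>+\<omega>. h (S \<omega>) \<partial>restrict_space M A)"
    using A by (simp add: nn_integral_restrict_space)
  also have "\<dots> = (\<integral>\<^sup>+u. h u \<partial>\<mu>)"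
    unfolding \<mu>_def using S_meas h by (simp add: nn_integral_distr)
  also have "\<dots> = (\<integral>\<^sup>+u. k u * indicator {\<tau><..t} u * h u \<partial>lborel)"
    unfolding \<open>\<mu> = \<nu>\<close> \<nu>_def using h by (subst nn_integral_density) auto
  also have "\<dots> = (\<integral>\<^sup>+u\<in>{\<tau><..t}. h u * g u \<partial>lborel)"
    by (intro nn_integral_cong) (auto simp: k_def mult_ac split: split_indicator)
  finally show ?thesis
    unfolding A_def S_def .
qed

section \<open>The strong Markov property for events that depend on the stopping time\<close>

context diffusion_family
begin

abbreviation "path_sigma \<equiv> path_space (einterval r1 r2)"

lemma
  assumes "y \<in> einterval r1 r2"
  shows prob_space_Q: "prob_space (Q y)" and sets_Q: "sets (Q y) = sets path_sigma"
  using measurable_space[OF kernel, of y] assms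
  by (auto simp: space_restrict_space space_prob_algebra)

lemma space_Q: "y \<in> einterval r1 r2 \<Longrightarrow> space (Q y) = space path_sigma"
  by (rule sets_eq_imp_space_eq) (rule sets_Q)

lemma measurable_Q_at:
  assumes "T \<in> borel_measurable path_sigma" "\<And>w. w \<in> space path_sigma \<Longrightarrow> 0 \<le> T w"
  shows "(\<lambda>w. Q (w (T w))) \<in> path_sigma \<rightarrow>\<^sub>M subprob_algebra path_sigma"
proof -
  have "(\<lambda>w. w (T w)) \<in> borel_measurable path_sigma"
    by (rule measurable_path_eval[where g = "\<lambda>w. w" and I = "einterval r1 r2"]) (use assms in auto)
  then have "(\<lambda>w. w (T w)) \<in> path_sigma \<rightarrow>\<^sub>M restrict_space borel (einterval r1 r2)"
    using assms(2) by (intro measurable_restrict_space2) (auto simp: space_path_space)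
  then show ?thesis
    by (rule measurable_compose) (rule measurable_prob_algebraD[OF kernel])
qed

text \<open>For a rectangle \<open>C \<times> B\<close> the condition \<open>T w \<in> C\<close> is
  absorbed into \<open>A\<close>, which stays an event prior to \<open>T\<close>, so
  \<open>strong_Markov\<close> applies. Both sides behave as finite measures in \<open>D\<close>,
  and rectangles form an intersection-stable generator, so Dynkin's argument reaches the whole
  product sigma-algebra.\<close>

lemma strong_Markov_joint:
  assumes y: "y \<in> einterval r1 r2"
    and T: "stopping_time (path_filtration (einterval r1 r2)) T"
    and nonneg: "\<And>w. w \<in> space path_sigma \<Longrightarrow> 0 \<le> T w"
    and A: "A \<in> sets (filtration.pre_sigma (space path_sigma) (path_filtration (einterval r1 r2)) T)"
    and D: "D \<in> sets (borel \<Otimes>\<^sub>M path_sigma)"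
  shows "emeasure (Q y) {w \<in> A. (T w, path_shift (T w) w) \<in> D}
    = (\<integral>\<^sup>+w\<in>A. emeasure (Q (w (T w))) (Pair (T w) -` D) \<partial>Q y)"
proof -
  interpret F: filtration "space path_sigma" "path_filtration (einterval r1 r2)"
    by (rule filtration_path_filtration)
  interpret prob_space "Q y"
    using y by (rule prob_space_Q)
  note [measurable_cong] = sets_Q[OF y]
  have T_meas [measurable]: "T \<in> borel_measurable path_sigma"
    using T by (rule measurable_stopping_time) (auto simp: space_path_filtration sets_path_filtration)
  have A_sub: "A \<subseteq> space path_sigma"
    using sets.sets_into_space[OF A] by (simp add: F.space_pre_sigma)
  \<comment> \<open>Membership in \<open>pre_sigma\<close> only speaks of \<open>A\<close>
    intersected with \<open>T \<le> n\<close>; since \<open>T\<close> is real-valued, these pieces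
    exhaust \<open>A\<close>.\<close>
  have "{w \<in> A. T w \<le> real n} \<in> sets path_sigma" for n
    using F.sets_pre_sigmaD[OF T A] sets_path_filtration by blast
  then have "(\<Union>n. {w \<in> A. T w \<le> real n}) \<in> sets path_sigma"
    by blast
  also have "(\<Union>n. {w \<in> A. T w \<le> real n}) = A"
    using real_arch_simple by blast
  finally have A_meas [measurable]: "A \<in> sets path_sigma" .
  have shift [measurable]: "(\<lambda>w. path_shift (T w) w) \<in> path_sigma \<rightarrow>\<^sub>M path_sigma"
    using nonneg by (intro measurable_path_shift) auto
  have kern [measurable]: "(\<lambda>w. Q (w (T w))) \<in> path_sigma \<rightarrow>\<^sub>M subprob_algebra path_sigma"
    using nonneg by (intro measurable_Q_at) auto
  have in_I: "w (T w) \<in> einterval r1 r2" if "w \<in> space path_sigma" for w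
    using nonneg[OF that] that by (auto simp: space_path_space)
  have meas_L [measurable]: "{w \<in> A. (T w, path_shift (T w) w) \<in> B} \<in> sets path_sigma"
    if "B \<in> sets (borel \<Otimes>\<^sub>M path_sigma)" for B
  proof -
    have [measurable]: "B \<in> sets (borel \<Otimes>\<^sub>M path_sigma)" by fact
    have "{w \<in> space path_sigma. w \<in> A \<and> (T w, path_shift (T w) w) \<in> B} \<in> sets path_sigma"
      by measurable
    also have "{w \<in> space path_sigma. w \<in> A \<and> (T w, path_shift (T w) w) \<in> B}
        = {w \<in> A. (T w, path_shift (T w) w) \<in> B}"
      using A_sub by auto
    finally show ?thesis .
  qed
  have meas_R [measurable]: "(\<lambda>w. emeasure (Q (w (T w))) (Pair (T w) -` B)) \<in> borel_measurable path_sigma"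
    if "B \<in> sets (borel \<Otimes>\<^sub>M path_sigma)" for B
  proof (rule emeasure_measurable_subprob_algebra2[OF _ kern])
    have [measurable]: "B \<in> sets (borel \<Otimes>\<^sub>M path_sigma)" by fact
    have "{x \<in> space (path_sigma \<Otimes>\<^sub>M path_sigma). (T (fst x), snd x) \<in> B}
        \<in> sets (path_sigma \<Otimes>\<^sub>M path_sigma)"
      by measurable
    also have "{x \<in> space (path_sigma \<Otimes>\<^sub>M path_sigma). (T (fst x), snd x) \<in> B}
        = (SIGMA w:space path_sigma. Pair (T w) -` B)"
      using sets.sets_into_space[OF that] by (auto simp: space_pair_measure)
    finally show "(SIGMA w:space path_sigma. Pair (T w) -` B) \<in> sets (path_sigma \<Otimes>\<^sub>M path_sigma)" .
  qed
  have meas_RA: "(\<lambda>w. emeasure (Q (w (T w))) (Pair (T w) -` B) * indicator A w) \<in> borel_measurable (Q y)"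
    if "B \<in> sets (borel \<Otimes>\<^sub>M path_sigma)" for B
    unfolding measurable_cong_sets[OF sets_Q[OF y] refl]
    using meas_R[OF that] A_meas by (intro borel_measurable_times_ennreal borel_measurable_indicator)
  have section_in: "Pair (T w) -` B \<in> sets (Q (w (T w)))"
    if "w \<in> space path_sigma" "B \<in> sets (borel \<Otimes>\<^sub>M path_sigma)" for B w
    using that in_I[OF that(1)] by (simp add: sets_Q sets_Pair1)
  let ?L = "\<lambda>B. {w \<in> A. (T w, path_shift (T w) w) \<in> B}"
  let ?R = "\<lambda>B. \<integral>\<^sup>+w\<in>A. emeasure (Q (w (T w))) (Pair (T w) -` B) \<partial>Q y"
  let ?G = "{C \<times> B | C B. C \<in> sets (borel::real measure) \<and> B \<in> sets path_sigma}"
  let ?\<Omega> = "space (borel::real measure) \<times> space path_sigma"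
  have sigma: "sigma_sets ?\<Omega> ?G = sets (borel \<Otimes>\<^sub>M path_sigma)"
    by (rule sets_pair_measure[symmetric])
  have "D \<in> sigma_sets ?\<Omega> ?G"
    using D by (subst sigma)
  with Int_stable_pair_measure_generator pair_measure_closed
  show "emeasure (Q y) (?L D) = ?R D"
  proof (induction rule: sigma_sets_induct_disjoint)
    case (basic D)
    then obtain C B where D: "D = C \<times> B" and C: "C \<in> sets borel" and B: "B \<in> sets path_sigma"
      by auto
    define A' where "A' = {w \<in> A. T w \<in> C}"
    have "A \<inter> (T -` C \<inter> space (F.pre_sigma T)) \<in> sets (F.pre_sigma T)"
      using A measurable_sets[OF F.measurable_stopping_time_pre_sigma[OF T] C] by blast
    also have "A \<inter> (T -` C \<inter> space (F.pre_sigma T)) = A'"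
      using A_sub by (auto simp: A'_def F.space_pre_sigma)
    finally have "emeasure (Q y) {w \<in> A'. path_shift (T w) w \<in> B}
        = (\<integral>\<^sup>+w\<in>A'. emeasure (Q (w (T w))) B \<partial>Q y)"
      by (intro strong_Markov[OF y T nonneg _ B])
    also have "\<dots> = ?R D"
      by (intro nn_integral_cong) (auto simp: A'_def D vimage_def split: split_indicator)
    also have "{w \<in> A'. path_shift (T w) w \<in> B} = ?L D"
      by (auto simp: A'_def D)
    finally show ?case .
  next
    case empty
    then show ?case by simp
  next
    case (compl D)
    then have D: "D \<in> sets (borel \<Otimes>\<^sub>M path_sigma)" "?\<Omega> - D \<in> sets (borel \<Otimes>\<^sub>M path_sigma)"
      unfolding sigma by (auto simp: space_pair_measure[symmetric])
    have shift_in: "path_shift (T w) w \<in> space path_sigma" if "w \<in> A" for w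
      using that A_sub nonneg by (auto intro: path_shift_in_space)
    \<comment> \<open>On each side, the contributions of \<open>D\<close> and of its complement add
      up to the measure of \<open>A\<close>. That measure is finite, so the equal terms for
      \<open>D\<close> can be cancelled.\<close>
    have "emeasure (Q y) (?L D) + emeasure (Q y) (?L (?\<Omega> - D)) = emeasure (Q y) (?L D \<union> ?L (?\<Omega> - D))"
      using D by (intro plus_emeasure) (auto simp: sets_Q[OF y] meas_L)
    also have "?L D \<union> ?L (?\<Omega> - D) = A"
      using shift_in by auto
    also have "emeasure (Q y) A = (\<integral>\<^sup>+w\<in>A. 1 \<partial>Q y)"
      by (simp add: sets_Q[OF y])
    also have "\<dots> = (\<integral>\<^sup>+w. emeasure (Q (w (T w))) (Pair (T w) -` D) * indicator A w
          + emeasure (Q (w (T w))) (Pair (T w) -` (?\<Omega> - D)) * indicator A w \<partial>Q y)"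
    proof (rule nn_integral_cong)
      fix w assume "w \<in> space (Q y)"
      then have w: "w \<in> space path_sigma"
        by (simp add: space_Q[OF y])
      have "emeasure (Q (w (T w))) (Pair (T w) -` D) + emeasure (Q (w (T w))) (Pair (T w) -` (?\<Omega> - D))
        = emeasure (Q (w (T w))) (Pair (T w) -` D \<union> Pair (T w) -` (?\<Omega> - D))"
        using w D by (intro plus_emeasure section_in) auto
      also have "Pair (T w) -` D \<union> Pair (T w) -` (?\<Omega> - D) = space (Q (w (T w)))"
        using sets.sets_into_space[OF D(1)] in_I[OF w] by (auto simp: space_Q space_pair_measure)
      finally show "1 * indicator A w = emeasure (Q (w (T w))) (Pair (T w) -` D) * indicator A w
          + emeasure (Q (w (T w))) (Pair (T w) -` (?\<Omega> - D)) * indicator A w"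
        using prob_space.emeasure_space_1[OF prob_space_Q[OF in_I[OF w]]]
        by (simp add: distrib_right[symmetric])
    qed
    also have "\<dots> = ?R D + ?R (?\<Omega> - D)"
      using D by (intro nn_integral_add meas_RA)
    finally have "emeasure (Q y) (?L D) + emeasure (Q y) (?L (?\<Omega> - D))
        = emeasure (Q y) (?L D) + ?R (?\<Omega> - D)"
      unfolding compl(2) .
    then show ?case
      unfolding ennreal_add_left_cancel using emeasure_finite by auto
  next
    case (union D)
    then have D: "D i \<in> sets (borel \<Otimes>\<^sub>M path_sigma)" for i
      unfolding sigma by auto
    have "emeasure (Q y) (?L (\<Union>i. D i)) = emeasure (Q y) (\<Union>i. ?L (D i))"
      by (rule arg_cong[where f = "emeasure (Q y)"]) auto
    also have "\<dots> = (\<Sum>i. emeasure (Q y) (?L (D i)))"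
      using union(1) D
      by (intro suminf_emeasure[symmetric]) (auto simp: sets_Q[OF y] meas_L disjoint_family_on_def)
    also have "\<dots> = (\<Sum>i. ?R (D i))"
      using union(3) by simp
    also have "\<dots> = (\<integral>\<^sup>+w. (\<Sum>i. emeasure (Q (w (T w))) (Pair (T w) -` D i) * indicator A w) \<partial>Q y)"
      using D by (intro nn_integral_suminf[symmetric] meas_RA)
    also have "\<dots> = ?R (\<Union>i. D i)"
    proof (rule nn_integral_cong)
      fix w assume "w \<in> space (Q y)"
      then have w: "w \<in> space path_sigma"
        by (simp add: space_Q[OF y])
      have "(\<Sum>i. emeasure (Q (w (T w))) (Pair (T w) -` D i))
          = emeasure (Q (w (T w))) (\<Union>i. Pair (T w) -` D i)"
        using union(1) D w
        by (intro suminf_emeasure) (auto simp: disjoint_family_on_def intro!: section_in)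
      then show "(\<Sum>i. emeasure (Q (w (T w))) (Pair (T w) -` D i) * indicator A w)
          = emeasure (Q (w (T w))) (Pair (T w) -` (\<Union>i. D i)) * indicator A w"
        by (simp add: vimage_UN ennreal_suminf_multc)
    qed
    finally show ?case .
  qed
qed

end

section \<open>Two boundaries hit in succession\<close>

lemma hitting_time_ge: "ereal \<tau> \<le> hitting_time \<tau> c Y"
  unfolding hitting_time_def by (rule Inf_greatest) auto

lemma hitting_time_attained:
  assumes "continuous_on {\<tau>..} c" "continuous_on {\<tau>..} Y" "hitting_time \<tau> c Y = ereal t"
  shows "\<tau> \<le> t" "Y t = c t"
  using assms(1,2) by (cases rule: hitting_time_cases; use assms(3) in simp)+

lemma measurable_path_hitting_time:
  assumes c: "continuous_on {\<tau>..} c"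
  shows "(\<lambda>w. hitting_time \<tau> c (\<lambda>t. w (t - \<tau>))) \<in> borel_measurable (path_space I)"
proof (rule borel_measurableI_le)
  fix x :: ereal
  show "{w \<in> space (path_space I). hitting_time \<tau> c (\<lambda>t. w (t - \<tau>)) \<le> x} \<in> sets (path_space I)"
  proof (cases x)
    case (real r)
    show ?thesis
      using pred_path_hitting_time_le_filtration[OF c, where I = I and u = "r - \<tau>"] sets_path_filtration
      unfolding real pred_def space_path_filtration by auto
  next
    case MInf
    have "\<not> hitting_time \<tau> c Y \<le> - \<infinity>" for Y
      using hitting_time_ge[of \<tau> c Y] by auto
    then show ?thesis
      unfolding MInf by simp
  qed auto
qed

text \<open>The strong Markov property is available for finite stopping times only, hence the cap.\<close>

definition capped_hitting :: "real \<Rightarrow> real \<Rightarrow> (real \<Rightarrow> real) \<Rightarrow> (real \<Rightarrow> real) \<Rightarrow> real" where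
  "capped_hitting n \<tau> c w = real_of_ereal (min (hitting_time \<tau> c (\<lambda>t. w (t - \<tau>))) (ereal (\<tau> + n))) - \<tau>"

text \<open>The minimum lies between \<tau> and \<open>\<tau> + n\<close>, so
  \<open>real_of_ereal\<close> never takes its default value and comparisons can be carried out in
  \<open>ereal\<close>.\<close>

lemma ereal_capped_hitting:
  assumes "0 \<le> n"
  shows "ereal (\<tau> + capped_hitting n \<tau> c w) = min (hitting_time \<tau> c (\<lambda>t. w (t - \<tau>))) (ereal (\<tau> + n))"
  using hitting_time_ge[of \<tau> c "\<lambda>t. w (t - \<tau>)"] assms unfolding capped_hitting_def
  by (cases "hitting_time \<tau> c (\<lambda>t. w (t - \<tau>))") (auto simp: min_def)

lemma capped_hitting_le_iff:
  assumes "0 \<le> n"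
  shows "capped_hitting n \<tau> c w \<le> u \<longleftrightarrow> n \<le> u \<or> hitting_time \<tau> c (\<lambda>t. w (t - \<tau>)) \<le> ereal (\<tau> + u)"
proof -
  have "capped_hitting n \<tau> c w \<le> u \<longleftrightarrow> ereal (\<tau> + capped_hitting n \<tau> c w) \<le> ereal (\<tau> + u)"
    by simp
  then show ?thesis
    unfolding ereal_capped_hitting[OF assms] min_le_iff_disj by auto
qed

lemma capped_hitting_nonneg:
  assumes "0 \<le> n"
  shows "0 \<le> capped_hitting n \<tau> c w"
proof -
  have "ereal \<tau> \<le> ereal (\<tau> + capped_hitting n \<tau> c w)"
    unfolding ereal_capped_hitting[OF assms] using hitting_time_ge assms by simp
  then show ?thesis by simp
qed

lemma stopping_time_capped_hitting:
  assumes c: "continuous_on {\<tau>..} c" and n: "0 \<le> n"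
  shows "stopping_time (path_filtration I) (capped_hitting n \<tau> c)"
proof
  fix u
  show "Measurable.pred (path_filtration I u) (\<lambda>w. capped_hitting n \<tau> c w \<le> u)"
    unfolding capped_hitting_le_iff[OF n] using pred_path_hitting_time_le_filtration[OF c]
    by (intro pred_intros_logic(5)) auto
qed

text \<open>The version of \<open>f\<close> measurable in all arguments together is composed with
  the continuous map \<open>(u, v) \<mapsto> (v, c u, u)\<close>, where \<open>c\<close> is frozen
  before \<open>t0\<close>. Hypothesis \<open>ne\<close> keeps the starting point off
  \<open>d\<close>, inside the region where \<open>f\<close> is specified.\<close>

lemma measurable_hitting_density_along:
  assumes dens: "hitting_densities Q I t0 d f"
    and c: "continuous_on {t0..} c" "\<And>t. t0 \<le> t \<Longrightarrow> c t \<in> I"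
    and ne: "\<And>t. t0 < t \<Longrightarrow> c t \<noteq> d t"
  shows "(\<lambda>(u, v). if t0 < u \<and> u < v then f v (c u) u else 0) \<in> borel_measurable borel"
proof -
  define B where "B = {(s, y, \<tau>). t0 \<le> \<tau> \<and> \<tau> < s \<and> y \<in> I \<and> y \<noteq> d \<tau>}"
  define \<Omega> where "\<Omega> = {p. t0 < fst p \<and> fst p < (snd p :: real)}"
  have "open \<Omega>"
    unfolding \<Omega>_def by (intro open_Collect_conj open_Collect_less continuous_intros)
  then have \<Omega>: "\<Omega> \<in> sets borel"
    by (rule borel_open)
  have f: "(\<lambda>(s, y, \<tau>). f s y \<tau>) \<in> borel_measurable (restrict_space borel B)"
    using dens unfolding hitting_densities_def B_def by simp
  define e where "e p = (snd p, c (max t0 (fst p)), fst p)" for p :: "real \<times> real"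
  have "continuous_on UNIV (\<lambda>p :: real \<times> real. max t0 (fst p))"
    by (intro continuous_intros)
  with c(1) have "continuous_on UNIV (\<lambda>p :: real \<times> real. c (max t0 (fst p)))"
    by (rule continuous_on_compose2) auto
  then have "continuous_on UNIV e"
    unfolding e_def by (intro continuous_intros)
  then have "e \<in> borel_measurable borel"
    by (rule borel_measurable_continuous_onI)
  then have "e \<in> restrict_space borel \<Omega> \<rightarrow>\<^sub>M restrict_space borel B"
    by (rule measurable_restrict_space3) (auto simp: e_def \<Omega>_def B_def c(2) ne)
  then have "(\<lambda>p. case e p of (s, y, \<tau>) \<Rightarrow> f s y \<tau>) \<in> borel_measurable (restrict_space borel \<Omega>)"
    using f by (rule measurable_compose)
  then have "(\<lambda>p. if p \<in> \<Omega> then case e p of (s, y, \<tau>) \<Rightarrow> f s y \<tau> else 0) \<in> borel_measurable borel"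
    using \<Omega> by (subst (asm) measurable_restrict_space_iff) auto
  also have "(\<lambda>p. if p \<in> \<Omega> then case e p of (s, y, \<tau>) \<Rightarrow> f s y \<tau> else 0)
      = (\<lambda>(u, v). if t0 < u \<and> u < v then f v (c u) u else 0)"
    by (auto simp: e_def \<Omega>_def fun_eq_iff)
  finally show ?thesis .
qed

lemma borel_measurable_extend_density:
  assumes "density_on M \<tau> T E g"
  shows "(\<lambda>u. if \<tau> < u then g u else 0) \<in> borel_measurable borel"
proof -
  have "(\<lambda>u. if u \<in> {\<tau><..} then g u else 0) \<in> borel_measurable borel"
    using assms unfolding density_on_def by (subst measurable_restrict_space_iff[symmetric]) auto
  then show ?thesis by simp
qed

context diffusion_family
begin

text \<open>Given \<open>Hc = u\<close>, the second hitting time is that of the process restarted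
  from \<open>c u\<close> at time \<open>u\<close>. The strong Markov property gives an integral
  over paths, \<open>g\<close> turns it into an integral over \<open>u\<close>, and Tonelli yields
  the double integral.\<close>

lemma emeasure_successive_hitting:
  fixes c d :: "real \<Rightarrow> real" and t0 :: real
  defines "Hc \<equiv> \<lambda>w. hitting_time t0 c (\<lambda>t. w (t - t0))"
    and "Hd \<equiv> \<lambda>w. hitting_time t0 d (\<lambda>t. w (t - t0))"
  assumes x0: "x0 \<in> einterval r1 r2"
    and c: "continuous_on {t0..} c" "\<And>t. t0 \<le> t \<Longrightarrow> c t \<in> einterval r1 r2"
    and d: "continuous_on {t0..} d"
    and ne: "\<And>t. t0 < t \<Longrightarrow> c t \<noteq> d t"
    and fd: "hitting_densities Q (einterval r1 r2) t0 d fd"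
    and g: "density_on (Q x0) t0 Hc (\<lambda>w. Hc w < Hd w) g"
    and t: "t0 \<le> t"
  shows "emeasure (Q x0) {w \<in> space (Q x0). (Hc w \<le> ereal t \<and> Hd w \<le> ereal s) \<and> Hc w < Hd w}
    = (\<integral>\<^sup>+(u, v)\<in>{t0<..t} \<times> {t0<..s}. (if u < v then fd v (c u) u * g u else 0) \<partial>(lborel \<Otimes>\<^sub>M lborel))"
proof -
  interpret F: filtration "space path_sigma" "path_filtration (einterval r1 r2)"
    by (rule filtration_path_filtration)
  interpret prob_space "Q x0"
    using x0 by (rule prob_space_Q)
  note [measurable_cong] = sets_Q[OF x0]
  have [measurable]: "Hc \<in> borel_measurable path_sigma" "Hd \<in> borel_measurable path_sigma"
    unfolding Hc_def Hd_def using c(1) d by (auto intro: measurable_path_hitting_time)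
  \<comment> \<open>The extra 1 puts the cap strictly beyond \<open>t\<close>, so that it never acts
    on \<open>Hc\<close> when \<open>Hc w \<le> ereal t\<close>.\<close>
  define n where "n = t - t0 + 1"
  have n: "0 \<le> n" "t < t0 + n"
    using t by (auto simp: n_def)
  define T S where "T = capped_hitting n t0 c" and "S = capped_hitting n t0 d"
  have stop: "stopping_time (path_filtration (einterval r1 r2)) T"
      "stopping_time (path_filtration (einterval r1 r2)) S"
    unfolding T_def S_def using c(1) d n(1) by (auto intro: stopping_time_capped_hitting)
  have T_nonneg: "0 \<le> T w" for w
    unfolding T_def by (rule capped_hitting_nonneg[OF n(1)])
  have T_eq: "ereal (t0 + T w) = min (Hc w) (ereal (t0 + n))"
      and S_eq: "ereal (t0 + S w) = min (Hd w) (ereal (t0 + n))" for w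
    unfolding T_def S_def Hc_def Hd_def by (simp_all only: ereal_capped_hitting[OF n(1)])
  define A where "A = {w \<in> space path_sigma. Hc w \<le> ereal t \<and> Hc w < Hd w}"
  \<comment> \<open>Since \<open>Hc\<close> stays below the cap here, capping \<open>Hd\<close> does
    not change the comparison. Stated with the finite stopping times \<open>T\<close> and
    \<open>S\<close>, the event is seen to be prior to \<open>T\<close>.\<close>
  have A_iff: "T w < S w \<and> T w \<le> t - t0 \<longleftrightarrow> Hc w \<le> ereal t \<and> Hc w < Hd w" for w
  proof -
    have "T w < S w \<longleftrightarrow> ereal (t0 + T w) < ereal (t0 + S w)"
      "T w \<le> t - t0 \<longleftrightarrow> ereal (t0 + T w) \<le> ereal t"
      by auto
    then show ?thesis
      unfolding T_eq S_eq using n(2) by (cases "Hc w"; cases "Hd w") (auto simp: min_def)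
  qed
  have Hc_eq: "Hc w = ereal (t0 + T w)" if "w \<in> A" for w
    using that n(2) unfolding T_eq A_def by (cases "Hc w") (auto simp: min_def)
  have A_pre: "A \<in> sets (F.pre_sigma T)"
  proof -
    have "{w \<in> space (F.pre_sigma T). T w < S w} \<in> sets (F.pre_sigma T)"
      using F.stopping_time_less[OF stop] unfolding pred_def .
    moreover have "T -` {..t - t0} \<inter> space (F.pre_sigma T) \<in> sets (F.pre_sigma T)"
      using F.measurable_stopping_time_pre_sigma[OF stop(1)] by (rule measurable_sets) simp
    ultimately have "{w \<in> space (F.pre_sigma T). T w < S w} \<inter> (T -` {..t - t0} \<inter> space (F.pre_sigma T))
        \<in> sets (F.pre_sigma T)"
      by blast
    also have "{w \<in> space (F.pre_sigma T). T w < S w} \<inter> (T -` {..t - t0} \<inter> space (F.pre_sigma T)) = A"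
      using A_iff unfolding A_def F.space_pre_sigma by auto
    finally show ?thesis .
  qed
  \<comment> \<open>The pairs (elapsed time, restarted path) for which \<open>d\<close> is hit by
    time \<open>s\<close>; the condition \<open>0 \<le> u\<close> keeps to times where
    \<open>d\<close> is continuous.\<close>
  define D where "D = {p \<in> space (borel \<Otimes>\<^sub>M path_sigma). case p of (u::real, w) \<Rightarrow>
    0 \<le> u \<and> hitting_time (t0 + u) d (\<lambda>t. w (t - (t0 + u))) \<le> ereal s}"
  have D: "D \<in> sets (borel \<Otimes>\<^sub>M path_sigma)"
    using pred_path_hitting_time_le_joint[OF d, where I = "einterval r1 r2" and s = s] unfolding D_def pred_def .
  define F where "F u v = (if t0 < u \<and> u < v then fd v (c u) u else 0)" for u v
  have "case_prod F \<in> borel_measurable borel"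
    unfolding F_def using measurable_hitting_density_along[OF fd c ne] by (simp add: case_prod_unfold)
  then have F_meas [measurable]: "case_prod F \<in> borel_measurable (borel \<Otimes>\<^sub>M borel)"
    by (simp add: borel_prod)
  \<comment> \<open>For \<open>t0 < u\<close>, this is the probability that the process started from
    \<open>c u\<close> at time \<open>u\<close> hits \<open>d\<close> by time
    \<open>s\<close>.\<close>
  define k where "k u = (\<integral>\<^sup>+v. F u v * indicator {..s} v \<partial>lborel)" for u
  have k [measurable]: "k \<in> borel_measurable borel"
    unfolding k_def by measurable
  define g' where "g' u = (if t0 < u then g u else 0)" for u
  have g' [measurable]: "g' \<in> borel_measurable borel"
    unfolding g'_def by (rule borel_measurable_extend_density[OF g])
  have "{w \<in> space (Q x0). (Hc w \<le> ereal t \<and> Hd w \<le> ereal s) \<and> Hc w < Hd w}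
      = {w \<in> A. (T w, path_shift (T w) w) \<in> D}"
  proof -
    have "(T w, path_shift (T w) w) \<in> D \<longleftrightarrow> Hd w \<le> ereal s" if wA: "w \<in> A" for w
    proof -
      have w: "w \<in> space path_sigma"
        using wA by (simp add: A_def)
      have d': "continuous_on {t0 + T w..} d"
        by (rule continuous_on_subset[OF d]) (use T_nonneg in auto)
      have sh: "path_shift (T w) w \<in> space path_sigma"
        using w T_nonneg by (rule path_shift_in_space)
      \<comment> \<open>On \<open>A\<close> the boundary \<open>d\<close> is not met up to time
        \<open>T w\<close>, so no meeting with \<open>d\<close> is lost by dropping the path before
        \<open>T w\<close>.\<close>
      have late: "T w < r" if "0 \<le> r" "w r = d (t0 + r)" for r
      proof (rule ccontr)
        assume "\<not> T w < r"
        moreover have "Hd w \<le> ereal (t0 + r)"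
          unfolding Hd_def path_hitting_time_le_iff[OF d w] using that by auto
        ultimately have "Hd w \<le> Hc w"
          unfolding Hc_eq[OF wA] by (cases "Hd w") auto
        then show False
          using wA by (simp add: A_def not_less[symmetric])
      qed
      have "(T w, path_shift (T w) w) \<in> D
          \<longleftrightarrow> (\<exists>r\<in>{0..s - (t0 + T w)}. path_shift (T w) w r - d (t0 + T w + r) = 0)"
        using sh T_nonneg[of w] path_hitting_time_le_iff[OF d' sh, of s]
        unfolding D_def by (simp add: space_pair_measure)
      also have "\<dots> \<longleftrightarrow> (\<exists>r\<in>{0..s - t0}. w r - d (t0 + r) = 0)" (is "?L \<longleftrightarrow> ?R")
      proof
        assume ?L
        then obtain r where "0 \<le> r" "r \<le> s - (t0 + T w)" "w (T w + r) = d (t0 + (T w + r))"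
          by (auto simp: path_shift_def add_ac)
        then show ?R
          using T_nonneg[of w] by (intro bexI[of _ "T w + r"]) auto
      next
        assume ?R
        then obtain r where r: "0 \<le> r" "r \<le> s - t0" "w r = d (t0 + r)"
          by auto
        with late[of r] show ?L
          by (intro bexI[of _ "r - T w"]) (auto simp: path_shift_def)
      qed
      also have "\<dots> \<longleftrightarrow> Hd w \<le> ereal s"
        unfolding Hd_def path_hitting_time_le_iff[OF d w] ..
      finally show ?thesis .
    qed
    then show ?thesis
      by (auto simp: space_Q[OF x0] A_def)
  qed
  then have "emeasure (Q x0) {w \<in> space (Q x0). (Hc w \<le> ereal t \<and> Hd w \<le> ereal s) \<and> Hc w < Hd w}
      = (\<integral>\<^sup>+w\<in>A. emeasure (Q (w (T w))) (Pair (T w) -` D) \<partial>Q x0)"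
    using strong_Markov_joint[OF x0 stop(1) T_nonneg A_pre D] by simp
  also have "\<dots> = (\<integral>\<^sup>+w\<in>A. k (real_of_ereal (Hc w)) \<partial>Q x0)"
  proof (rule nn_integral_cong_AE)
    \<comment> \<open>Taking \<open>t = t0\<close> in \<open>density_on\<close> gives an integral
      over an empty interval, so \<open>Hc = t0\<close> has no mass on \<open>Hc < Hd\<close>. These
      paths are discarded because \<open>c\<close> and \<open>d\<close> are assumed to differ only
      after \<open>t0\<close>, and \<open>k\<close> is 0 at \<open>t0\<close>.\<close>
    have "emeasure (Q x0) {w \<in> space (Q x0). Hc w \<le> ereal t0 \<and> Hc w < Hd w} = 0"
      using g unfolding density_on_def by (simp add: less_eq_real_def)
    then have "AE w in Q x0. \<not> (Hc w \<le> ereal t0 \<and> Hc w < Hd w)"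
      by (intro AE_I[where N = "{w \<in> space (Q x0). Hc w \<le> ereal t0 \<and> Hc w < Hd w}"]) auto
    with AE_space
    show "AE w in Q x0. emeasure (Q (w (T w))) (Pair (T w) -` D) * indicator A w
        = k (real_of_ereal (Hc w)) * indicator A w"
    proof eventually_elim
      case (elim w)
      show ?case
      proof (cases "w \<in> A")
        case True
        then have w: "w \<in> space path_sigma" and less: "Hc w < Hd w"
          by (auto simp: A_def)
        define h where "h = t0 + T w"
        have Hc: "Hc w = ereal h"
          unfolding h_def by (rule Hc_eq[OF True])
        have h: "t0 < h"
          using elim less by (simp add: Hc)
        have "w (h - t0) = c h"
          using hitting_time_attained(2)[OF c(1) continuous_on_shifted_path[OF w]] Hc unfolding Hc_def by simp
        then have wT: "w (T w) = c h"
          by (simp add: h_def)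
        have ch: "c h \<in> einterval r1 r2" "c h \<noteq> d h"
          using c(2) ne h by auto
        have "Pair (T w) -` D = {v \<in> space (Q (c h)). hitting_time h d (\<lambda>t. v (t - h)) \<le> ereal s}"
          unfolding space_Q[OF ch(1)] using T_nonneg[of w] by (auto simp: D_def space_pair_measure h_def)
        also have "emeasure (Q (c h)) \<dots> = (\<integral>\<^sup>+v\<in>{h<..s}. fd v (c h) h \<partial>lborel)"
        \<comment> \<open>\<open>hitting_densities\<close> speaks only of times from the start
          \<open>h\<close> on; for \<open>s < h\<close> the event and the interval of integration
          are both empty.\<close>
        proof (cases "h \<le> s")
          case True
          then show ?thesis
            using fd h ch unfolding hitting_densities_def density_on_def by simp
        next
          case False
          then have "\<not> hitting_time h d Y \<le> ereal s" for Y
            using hitting_time_ge[of h d Y] by (auto dest: order_trans)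
          with False show ?thesis by simp
        qed
        also have "\<dots> = k h"
          unfolding k_def F_def using h by (intro nn_integral_cong) (auto split: split_indicator)
        finally show ?thesis
          by (simp add: wT Hc)
      qed simp
    qed
  qed
  also have "\<dots> = (\<integral>\<^sup>+u\<in>{t0<..t}. k u * g u \<partial>lborel)"
  proof -
    have "A = {w \<in> space (Q x0). Hc w \<le> ereal t \<and> Hc w < Hd w}"
      by (simp add: A_def space_Q[OF x0])
    moreover have "{w \<in> space (Q x0). Hc w \<le> ereal t' \<and> Hc w < Hd w} \<in> sets (Q x0)" for t'
      by measurable
    moreover have "ereal t0 \<le> Hc w" for w
      unfolding Hc_def by (rule hitting_time_ge)
    ultimately show ?thesis
      using nn_integral_density_on[OF finite_measure_axioms g _ _ t k] by simp
  qed
  \<comment> \<open>The factor depending on \<open>u\<close> moves inside the inner integral, with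
    \<open>g\<close> replaced by its Borel extension \<open>g'\<close>, to prepare for
    Tonelli.\<close>
  also have "\<dots> = (\<integral>\<^sup>+u. (\<integral>\<^sup>+v. F u v * indicator {..s} v * (g' u * indicator {t0<..t} u) \<partial>lborel) \<partial>lborel)"
  proof (rule nn_integral_cong)
    fix u
    have "(\<integral>\<^sup>+v. F u v * indicator {..s} v * (g' u * indicator {t0<..t} u) \<partial>lborel)
        = k u * (g' u * indicator {t0<..t} u)"
      unfolding k_def by (rule nn_integral_multc) measurable
    then show "k u * g u * indicator {t0<..t} u
        = (\<integral>\<^sup>+v. F u v * indicator {..s} v * (g' u * indicator {t0<..t} u) \<partial>lborel)"
      by (simp add: g'_def split: split_indicator)
  qed
  also have "\<dots> = (\<integral>\<^sup>+(u, v). F u v * indicator {..s} v * (g' u * indicator {t0<..t} u) \<partial>(lborel \<Otimes>\<^sub>M lborel))"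
    by (subst lborel.nn_integral_fst[symmetric]) auto
  also have "\<dots> = (\<integral>\<^sup>+(u, v)\<in>{t0<..t} \<times> {t0<..s}. (if u < v then fd v (c u) u * g u else 0) \<partial>(lborel \<Otimes>\<^sub>M lborel))"
    by (intro nn_integral_cong) (auto simp: F_def g'_def indicator_def split: if_splits)
  finally show ?thesis .
qed

end

section \<open>The joint density\<close>

text \<open>Both factors are first extended by 0 to Borel functions; on the quadrant the product of
  the extensions is the given function.\<close>

lemma measurable_successive_hitting_density:
  assumes "hitting_densities Q I t0 d f"
    and "continuous_on {t0..} c" "\<And>t. t0 \<le> t \<Longrightarrow> c t \<in> I"
    and "\<And>t. t0 < t \<Longrightarrow> c t \<noteq> d t"
    and g: "density_on M t0 T E g"
  shows "(\<lambda>(u, v). if u < v then f v (c u) u * g u else 0)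
    \<in> borel_measurable (restrict_space borel ({t0<..} \<times> {t0<..}))"
proof -
  have f': "(\<lambda>p. case p of (u, v) \<Rightarrow> if t0 < u \<and> u < v then f v (c u) u else 0) \<in> borel_measurable borel"
    by (rule measurable_hitting_density_along) fact+
  have fst: "fst \<in> borel_measurable (borel :: (real \<times> real) measure)"
    by (intro borel_measurable_continuous_onI continuous_intros)
  have "(\<lambda>p. (case p of (u, v) \<Rightarrow> if t0 < u \<and> u < v then f v (c u) u else 0)
      * (if t0 < fst p then g (fst p) else 0)) \<in> borel_measurable borel"
    by (rule borel_measurable_times_ennreal[OF f' measurable_compose[OF fst borel_measurable_extend_density[OF g]]])
  then have "(\<lambda>p. (case p of (u, v) \<Rightarrow> if t0 < u \<and> u < v then f v (c u) u else 0)
      * (if t0 < fst p then g (fst p) else 0)) \<in> borel_measurable (restrict_space borel ({t0<..} \<times> {t0<..}))"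
    by (rule measurable_restrict_space1)
  also have "?this \<longleftrightarrow> ?thesis"
    by (rule measurable_cong) (auto simp: space_restrict_space)
  finally show ?thesis .
qed

lemma nn_integral_lborel_pair_swap:
  fixes f :: "real \<times> real \<Rightarrow> ennreal"
  assumes "f \<in> borel_measurable (lborel \<Otimes>\<^sub>M lborel)"
  shows "(\<integral>\<^sup>+(x, y). f (y, x) \<partial>(lborel \<Otimes>\<^sub>M lborel)) = (\<integral>\<^sup>+p. f p \<partial>(lborel \<Otimes>\<^sub>M lborel))"
  using assms
  by (subst (2) lborel_pair.distr_pair_swap) (auto simp: nn_integral_distr case_prod_unfold)

text \<open>Reflection turns boundaries below the starting point into boundaries above it.\<close>

lemma hitting_time_uminus:
  "hitting_time \<tau> (\<lambda>t. - c t) (\<lambda>t. - Y t) = hitting_time \<tau> c Y"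
  by (simp add: hitting_time_def)

text \<open>When the path meets \<open>d\<close> it is strictly above \<open>c\<close>, but it
  started below \<open>c\<close>; the intermediate value theorem gives a strictly earlier meeting
  with \<open>c\<close>. Hypothesis \<open>fin\<close> excludes the case of two infinite hitting
  times, where strictness fails.\<close>

lemma hitting_time_less_of_below:
  assumes c: "continuous_on {\<tau>..} c" and d: "continuous_on {\<tau>..} d" and Y: "continuous_on {\<tau>..} Y"
    and less: "\<And>t. \<tau> \<le> t \<Longrightarrow> c t < d t" and start: "Y \<tau> < c \<tau>"
    and fin: "hitting_time \<tau> c Y \<noteq> \<infinity>"
  shows "hitting_time \<tau> c Y < hitting_time \<tau> d Y"
  using c Y
proof (cases rule: hitting_time_cases)
  case never
  with fin show ?thesis by simp
next
  case (hit h)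
  show ?thesis
    using d Y
  proof (cases rule: hitting_time_cases)
    case never
    with hit(1) show ?thesis by simp
  next
    case hit': (hit h')
    have "h < h'"
    proof (rule ccontr)
      assume "\<not> h < h'"
      have Yc: "Y h' > c h'"
        using hit'(2,3) less by simp
      have "continuous_on {\<tau>..h'} (\<lambda>t. Y t - c t)"
        by (intro continuous_on_diff continuous_on_subset[OF Y] continuous_on_subset[OF c]) auto
      then have "\<exists>r\<ge>\<tau>. r \<le> h' \<and> Y r - c r = 0"
        using start hit'(2) Yc by (intro IVT') auto
      then obtain r where r: "\<tau> \<le> r" "r \<le> h'" "Y r = c r"
        by auto
      with Yc have "r < h'"
        by (cases "r = h'") auto
      with r \<open>\<not> h < h'\<close> hit(4)[of r] show False by auto
    qed
    with hit(1) hit'(1) show ?thesis by simp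
  qed
qed

lemma boundaryD:
  assumes "boundary I t0 c"
  shows "continuous_on {t0..} c" "t0 \<le> t \<Longrightarrow> c t \<in> I"
  using assms by (auto simp: boundary_def)

section \<open>Transfer from the path law to the process, and the two configurations\<close>

context diffusion_process
begin

text \<open>The restriction to \<open>{0..}\<close> makes the path extensional, as the points of
  \<open>path_space\<close> are; this is the map whose distribution \<open>law\<close>
  identifies.\<close>

definition elapsed_path :: "'a \<Rightarrow> real \<Rightarrow> real" where
  "elapsed_path \<omega> = (\<lambda>u\<in>{0..}. X (t0 + u) \<omega>)"

lemma measurable_elapsed_path: "elapsed_path \<in> M \<rightarrow>\<^sub>M path_sigma"
proof (rule measurable_path_spaceI)
  show "(\<lambda>\<omega>. elapsed_path \<omega> r) \<in> borel_measurable M" if "0 \<le> r" for r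
    using measurable_X[of "t0 + r"] that by (simp add: elapsed_path_def)
next
  fix \<omega> assume \<omega>: "\<omega> \<in> space M"
  have "continuous_on {0..} (\<lambda>u. t0 + u)"
    by (intro continuous_intros)
  with continuous_X[OF \<omega>] have "continuous_on {0..} (\<lambda>u. X (t0 + u) \<omega>)"
    by (rule continuous_on_compose2) auto
  then have "continuous_on {0..} (elapsed_path \<omega>)"
    by (subst continuous_on_cong[OF refl, where g = "\<lambda>u. X (t0 + u) \<omega>"]) (auto simp: elapsed_path_def)
  then show "elapsed_path \<omega> \<in> space path_sigma"
    using X_in[OF \<omega>] by (auto simp: space_path_space elapsed_path_def)
qed

lemma distr_elapsed_path: "distr M path_sigma elapsed_path = Q x0"
  using law by (simp add: elapsed_path_def[abs_def])

lemma hitting_time_elapsed_path: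
  "hitting_time t0 c (\<lambda>t. elapsed_path \<omega> (t - t0)) = hitting_time t0 c (\<lambda>t. X t \<omega>)"
  unfolding hitting_time_def by (rule arg_cong[where f = Inf]) (auto simp: elapsed_path_def)

lemma measurable_hitting_time_X:
  assumes "continuous_on {t0..} c"
  shows "(\<lambda>\<omega>. hitting_time t0 c (\<lambda>t. X t \<omega>)) \<in> borel_measurable M"
  using measurable_compose[OF measurable_elapsed_path measurable_path_hitting_time[OF assms]]
  by (simp add: hitting_time_elapsed_path)

text \<open>The relation \<open>R\<close> is left general so that one transfer serves marginal
  events, joint events and events that compare the two times.\<close>

lemma emeasure_hitting_times:
  assumes c: "continuous_on {t0..} c" and d: "continuous_on {t0..} d"
    and R: "Measurable.pred (borel \<Otimes>\<^sub>M borel) (\<lambda>(x, y). R x y)"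
  shows "emeasure M {\<omega> \<in> space M. R (hitting_time t0 c (\<lambda>t. X t \<omega>)) (hitting_time t0 d (\<lambda>t. X t \<omega>))}
    = emeasure (Q x0) {w \<in> space (Q x0).
        R (hitting_time t0 c (\<lambda>t. w (t - t0))) (hitting_time t0 d (\<lambda>t. w (t - t0)))}"
proof -
  let ?H = "\<lambda>w. (hitting_time t0 c (\<lambda>t. w (t - t0)), hitting_time t0 d (\<lambda>t. w (t - t0)))"
  have "?H \<in> path_sigma \<rightarrow>\<^sub>M borel \<Otimes>\<^sub>M borel"
    using c d by (intro measurable_Pair measurable_path_hitting_time)
  from measurable_compose[OF this R]
  have "{w \<in> space path_sigma. R (fst (?H w)) (snd (?H w))} \<in> sets path_sigma" (is "?B \<in> _")
    by (simp add: pred_def)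
  then have "emeasure (Q x0) ?B = emeasure M (elapsed_path -` ?B \<inter> space M)"
    unfolding distr_elapsed_path[symmetric] by (intro emeasure_distr measurable_elapsed_path)
  also have "elapsed_path -` ?B \<inter> space M
      = {\<omega> \<in> space M. R (hitting_time t0 c (\<lambda>t. X t \<omega>)) (hitting_time t0 d (\<lambda>t. X t \<omega>))}"
    using measurable_space[OF measurable_elapsed_path] by (auto simp: hitting_time_elapsed_path)
  finally show ?thesis
    by (simp add: space_Q[OF x0_in])
qed

lemma AE_start: "AE \<omega> in M. X t0 \<omega> = x0"
proof -
  have "AE w in distr M path_sigma elapsed_path. w 0 = x0"
    unfolding distr_elapsed_path by (rule start[OF x0_in])
  then have "AE \<omega> in M. elapsed_path \<omega> 0 = x0"
    by (rule AE_distrD[OF measurable_elapsed_path])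
  then show ?thesis
    by (simp add: elapsed_path_def)
qed

lemma density_on_hitting_time_X:
  assumes x0: "x0 \<noteq> c t0" and c: "boundary (einterval r1 r2) t0 c"
    and "hitting_densities Q (einterval r1 r2) t0 c f"
  shows "density_on M t0 (\<lambda>\<omega>. hitting_time t0 c (\<lambda>t. X t \<omega>)) (\<lambda>_. True) (\<lambda>t. f t x0 t0)"
proof -
  \<comment> \<open>The marginal is treated as a pair with both boundaries equal to
    \<open>c\<close>; the conjunct \<open>True\<close> matches the event \<open>E\<close> in
    \<open>density_on\<close>.\<close>
  have "Measurable.pred (borel \<Otimes>\<^sub>M borel) (\<lambda>(x :: ereal, y :: ereal). x \<le> ereal t \<and> True)" for t
    by measurable
  note eq = emeasure_hitting_times[OF boundaryD(1)[OF c] boundaryD(1)[OF c] this]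
  have "density_on (Q x0) t0 (\<lambda>w. hitting_time t0 c (\<lambda>t. w (t - t0))) (\<lambda>_. True) (\<lambda>t. f t x0 t0)"
    using assms x0_in by (simp add: hitting_densities_def)
  then show ?thesis
    unfolding density_on_def eq .
qed

lemma emeasure_successive_hitting_X:
  fixes c d :: "real \<Rightarrow> real"
  defines "Tc \<equiv> \<lambda>\<omega>. hitting_time t0 c (\<lambda>t. X t \<omega>)"
    and "Td \<equiv> \<lambda>\<omega>. hitting_time t0 d (\<lambda>t. X t \<omega>)"
  assumes c: "boundary (einterval r1 r2) t0 c" and d: "boundary (einterval r1 r2) t0 d"
    and ne: "\<And>t. t0 < t \<Longrightarrow> c t \<noteq> d t"
    and f: "hitting_densities Q (einterval r1 r2) t0 d f"
    and g: "density_on M t0 Tc (\<lambda>\<omega>. Tc \<omega> < Td \<omega>) g"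
    and t: "t0 \<le> t"
  shows "emeasure M {\<omega> \<in> space M. (Tc \<omega> \<le> ereal t \<and> Td \<omega> \<le> ereal s) \<and> Tc \<omega> < Td \<omega>}
    = (\<integral>\<^sup>+(u, v)\<in>{t0<..t} \<times> {t0<..s}. (if u < v then f v (c u) u * g u else 0) \<partial>(lborel \<Otimes>\<^sub>M lborel))"
proof -
  note cont = boundaryD(1)[OF c] boundaryD(1)[OF d]
  have "Measurable.pred (borel \<Otimes>\<^sub>M borel) (\<lambda>(x :: ereal, y). x \<le> ereal t \<and> x < y)" for t
    by measurable
  note eq = emeasure_hitting_times[OF cont this]
  have "density_on (Q x0) t0 (\<lambda>w. hitting_time t0 c (\<lambda>t. w (t - t0)))
      (\<lambda>w. hitting_time t0 c (\<lambda>t. w (t - t0)) < hitting_time t0 d (\<lambda>t. w (t - t0))) g"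
    using g unfolding density_on_def Tc_def Td_def eq .
  note succ = emeasure_successive_hitting[OF x0_in cont(1) boundaryD(2)[OF c] cont(2) ne f this t]
  have "Measurable.pred (borel \<Otimes>\<^sub>M borel) (\<lambda>(x :: ereal, y). (x \<le> ereal t \<and> y \<le> ereal s) \<and> x < y)"
    by measurable
  note eq' = emeasure_hitting_times[OF cont this]
  show ?thesis
    unfolding Tc_def Td_def eq' by (rule succ)
qed

text \<open>Almost surely \<open>a\<close> is hit before \<open>b\<close> whenever it is hit at all.
  Hence the density of \<open>Ta\<close> is also its density on \<open>Ta < Tb\<close>, and the
  joint distribution function is carried by that event.\<close>

lemma joint_density_crossing:
  fixes a b :: "real \<Rightarrow> real"
  defines "Ta \<equiv> \<lambda>\<omega>. hitting_time t0 a (\<lambda>t. X t \<omega>)"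
    and "Tb \<equiv> \<lambda>\<omega>. hitting_time t0 b (\<lambda>t. X t \<omega>)"
  assumes a: "boundary (einterval r1 r2) t0 a" and b: "boundary (einterval r1 r2) t0 b"
    and fa: "hitting_densities Q (einterval r1 r2) t0 a fa"
    and fb: "hitting_densities Q (einterval r1 r2) t0 b fb"
    and order: "x0 < a t0 \<and> (\<forall>t\<ge>t0. a t < b t) \<or> a t0 < x0 \<and> (\<forall>t\<ge>t0. b t < a t)"
  shows "joint_density_of M t0 Ta Tb (\<lambda>t s. if t \<ge> s then 0 else fa t x0 t0 * fb s (a t) t)"
proof -
  note cont = boundaryD(1)[OF a] boundaryD(1)[OF b]
  have [measurable]: "Ta \<in> borel_measurable M" "Tb \<in> borel_measurable M"
    unfolding Ta_def Tb_def using cont by (auto intro: measurable_hitting_time_X)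
  have ne: "a t \<noteq> b t" if "t0 < t" for t
    using order that by (metis less_imp_le less_irrefl)
  have less: "AE \<omega> in M. Ta \<omega> \<noteq> \<infinity> \<longrightarrow> Ta \<omega> < Tb \<omega>"
    using AE_start AE_space
  proof eventually_elim
    case (elim \<omega>)
    have X: "continuous_on {t0..} (\<lambda>t. X t \<omega>)"
      using elim by (intro continuous_X)
    from order show ?case
    proof
      assume "x0 < a t0 \<and> (\<forall>t\<ge>t0. a t < b t)"
      then show ?case
        using hitting_time_less_of_below[OF cont X] elim by (simp add: Ta_def Tb_def)
    next
      assume "a t0 < x0 \<and> (\<forall>t\<ge>t0. b t < a t)"
      \<comment> \<open>Negating both boundaries and the path reduces this configuration to the
        previous one.\<close>
      then show ?case
        using hitting_time_less_of_below[OF cont[THEN continuous_on_minus] X[THEN continuous_on_minus]] elim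
        unfolding hitting_time_uminus by (simp add: Ta_def Tb_def)
    qed
  qed
  have "x0 \<noteq> a t0"
    using order by auto
  from density_on_hitting_time_X[OF this a fa]
  have fa': "density_on M t0 Ta (\<lambda>_. True) (\<lambda>t. fa t x0 t0)"
    unfolding Ta_def .
  have "emeasure M {\<omega> \<in> space M. Ta \<omega> \<le> ereal t \<and> True}
      = emeasure M {\<omega> \<in> space M. Ta \<omega> \<le> ereal t \<and> Ta \<omega> < Tb \<omega>}" for t
    using less by (intro emeasure_eq_AE) auto
  with fa' have g: "density_on M t0 Ta (\<lambda>\<omega>. Ta \<omega> < Tb \<omega>) (\<lambda>t. fa t x0 t0)"
    unfolding density_on_def by simp
  have eq: "(if s \<le> t then 0 else fa t x0 t0 * fb s (a t) t)
      = (if t < s then fb s (a t) t * fa t x0 t0 else 0)" for s t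
    by (auto simp: mult.commute)
  show ?thesis
    unfolding joint_density_of_def eq
  proof (intro conjI allI impI)
    show "(\<lambda>(t, s). if t < s then fb s (a t) t * fa t x0 t0 else 0)
        \<in> borel_measurable (restrict_space borel ({t0<..} \<times> {t0<..}))"
      by (rule measurable_successive_hitting_density[OF fb boundaryD[OF a] ne g])
    fix t s assume "t0 \<le> t"
    have "emeasure M {\<omega> \<in> space M. Ta \<omega> \<le> ereal t \<and> Tb \<omega> \<le> ereal s}
        = emeasure M {\<omega> \<in> space M. (Ta \<omega> \<le> ereal t \<and> Tb \<omega> \<le> ereal s) \<and> Ta \<omega> < Tb \<omega>}"
      using less by (intro emeasure_eq_AE) auto
    also have "\<dots> = (\<integral>\<^sup>+(u, v)\<in>{t0<..t} \<times> {t0<..s}.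
        (if u < v then fb v (a u) u * fa u x0 t0 else 0) \<partial>(lborel \<Otimes>\<^sub>M lborel))"
      using g \<open>t0 \<le> t\<close> unfolding Ta_def Tb_def by (intro emeasure_successive_hitting_X a b ne fb)
    finally show "emeasure M {\<omega> \<in> space M. Ta \<omega> \<le> ereal t \<and> Tb \<omega> \<le> ereal s} = \<dots>" .
  qed
qed

text \<open>The event is split according to which boundary is hit first, and the formula for
  successive hits is applied to each half, the second time with \<open>a\<close> and
  \<open>b\<close> exchanged.\<close>

lemma joint_density_exit:
  fixes a b :: "real \<Rightarrow> real"
  defines "Ta \<equiv> \<lambda>\<omega>. hitting_time t0 a (\<lambda>t. X t \<omega>)"
    and "Tb \<equiv> \<lambda>\<omega>. hitting_time t0 b (\<lambda>t. X t \<omega>)"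
  assumes a: "boundary (einterval r1 r2) t0 a" and b: "boundary (einterval r1 r2) t0 b"
    and fa: "hitting_densities Q (einterval r1 r2) t0 a fa"
    and fb: "hitting_densities Q (einterval r1 r2) t0 b fb"
    and ne: "\<And>t. t0 \<le> t \<Longrightarrow> a t \<noteq> b t"
    and ga: "density_on M t0 Ta (\<lambda>\<omega>. Ta \<omega> < Tb \<omega>) ga"
    and gb: "density_on M t0 Tb (\<lambda>\<omega>. Tb \<omega> < Ta \<omega>) gb"
  shows "joint_density_of M t0 Ta Tb
    (\<lambda>t s. if t < s then fb s (a t) t * ga t else if t = s then 0 else fa t (b s) s * gb s)"
proof -
  note cont = boundaryD(1)[OF a] boundaryD(1)[OF b]
  have [measurable]: "Ta \<in> borel_measurable M" "Tb \<in> borel_measurable M"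
    unfolding Ta_def Tb_def using cont by (auto intro: measurable_hitting_time_X)
  have ne_ab: "a t \<noteq> b t" and ne_ba: "b t \<noteq> a t" if "t0 < t" for t
    using ne[of t] that by auto
  define \<Omega> where "\<Omega> = {t0<..} \<times> {t0<..}"
  \<comment> \<open>The arguments of \<open>Jb\<close> come in order of hitting, the time of
    \<open>b\<close> first; its coordinates must therefore be swapped before the two parts are
    added.\<close>
  define Ja Jb where "Ja = (\<lambda>(u, v). if u < v then fb v (a u) u * ga u else 0)"
    and "Jb = (\<lambda>(v, u). if v < u then fa u (b v) v * gb v else 0)"
  have Ja: "Ja \<in> borel_measurable (restrict_space borel \<Omega>)"
    unfolding Ja_def \<Omega>_def
    by (rule measurable_successive_hitting_density[OF fb boundaryD[OF a] ne_ab ga])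
  have Jb: "Jb \<in> borel_measurable (restrict_space borel \<Omega>)"
    unfolding Jb_def \<Omega>_def
    by (rule measurable_successive_hitting_density[OF fa boundaryD[OF b] ne_ba gb])
  have "(\<lambda>p. (snd p, fst p)) \<in> borel_measurable (borel :: (real \<times> real) measure)"
    by (intro borel_measurable_continuous_onI continuous_intros)
  then have "(\<lambda>p. (snd p, fst p)) \<in> restrict_space borel \<Omega> \<rightarrow>\<^sub>M restrict_space borel \<Omega>"
    by (rule measurable_restrict_space3) (auto simp: \<Omega>_def)
  from measurable_compose[OF this Jb]
  have Jb': "(\<lambda>p. Jb (snd p, fst p)) \<in> borel_measurable (restrict_space borel \<Omega>)" .
  \<comment> \<open>At most one summand is nonzero at any point, and both vanish on the diagonal,
    which gives the value 0 there.\<close>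
  have eq: "(if u < v then fb v (a u) u * ga u else if u = v then 0 else fa u (b v) v * gb v)
      = Ja (u, v) + Jb (v, u)" for u v
    by (auto simp: Ja_def Jb_def)
  \<comment> \<open>Measurability is known only on the quadrant \<Omega>. The box lies inside
    \<Omega>, so a further factor \<open>indicator \<Omega>\<close> changes nothing and makes the
    integrand Borel.\<close>
  have box: "(\<lambda>p. f p * indicator ({t0<..t} \<times> {t0<..s}) p) \<in> borel_measurable (lborel \<Otimes>\<^sub>M lborel)"
    if f: "f \<in> borel_measurable (restrict_space borel \<Omega>)" for f :: "real \<times> real \<Rightarrow> ennreal" and t s
  proof -
    have "open \<Omega>"
      unfolding \<Omega>_def by (intro open_Times) auto
    then have "(\<lambda>p. f p * indicator \<Omega> p) \<in> borel_measurable borel"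
      using f by (subst (asm) borel_measurable_restrict_space_iff_ennreal) auto
    moreover have "{t0<..t} \<times> {t0<..s} \<in> sets (borel :: (real \<times> real) measure)"
      unfolding borel_prod[symmetric] by (intro pair_measureI) auto
    ultimately have "(\<lambda>p. f p * indicator \<Omega> p * indicator ({t0<..t} \<times> {t0<..s}) p) \<in> borel_measurable borel"
      by (rule borel_measurable_times_ennreal[OF _ borel_measurable_indicator])
    also have "(\<lambda>p. f p * indicator \<Omega> p * indicator ({t0<..t} \<times> {t0<..s}) p)
        = (\<lambda>p. f p * indicator ({t0<..t} \<times> {t0<..s}) p)"
      by (auto simp: fun_eq_iff \<Omega>_def split: split_indicator)
    finally show ?thesis
      by (simp add: lborel_prod)
  qed
  show ?thesis
    unfolding joint_density_of_def eq
  proof (intro conjI allI impI)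
    have "(\<lambda>p. Ja p + Jb (snd p, fst p)) \<in> borel_measurable (restrict_space borel \<Omega>)"
      using Ja Jb' by (rule borel_measurable_add)
    then show "(\<lambda>(t, s). Ja (t, s) + Jb (s, t)) \<in> borel_measurable (restrict_space borel ({t0<..} \<times> {t0<..}))"
      by (simp add: \<Omega>_def case_prod_unfold)
    fix t s assume t: "t0 \<le> t" and s: "t0 \<le> s"
    let ?A = "{\<omega> \<in> space M. (Ta \<omega> \<le> ereal t \<and> Tb \<omega> \<le> ereal s) \<and> Ta \<omega> < Tb \<omega>}"
    let ?B = "{\<omega> \<in> space M. (Tb \<omega> \<le> ereal s \<and> Ta \<omega> \<le> ereal t) \<and> Tb \<omega> < Ta \<omega>}"
    have A: "emeasure M ?A = (\<integral>\<^sup>+p. Ja p * indicator ({t0<..t} \<times> {t0<..s}) p \<partial>(lborel \<Otimes>\<^sub>M lborel))"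
      unfolding Ja_def Ta_def Tb_def
      by (rule emeasure_successive_hitting_X[OF a b ne_ab fb ga[unfolded Ta_def Tb_def] t])
    have "emeasure M ?B = (\<integral>\<^sup>+p. Jb p * indicator ({t0<..s} \<times> {t0<..t}) p \<partial>(lborel \<Otimes>\<^sub>M lborel))"
      unfolding Jb_def Ta_def Tb_def
      by (rule emeasure_successive_hitting_X[OF b a ne_ba fa gb[unfolded Ta_def Tb_def] s])
    also have "\<dots> = (\<integral>\<^sup>+(u, v). Jb (v, u) * indicator ({t0<..s} \<times> {t0<..t}) (v, u) \<partial>(lborel \<Otimes>\<^sub>M lborel))"
      by (rule nn_integral_lborel_pair_swap[symmetric]) (rule box[OF Jb])
    also have "\<dots> = (\<integral>\<^sup>+p. Jb (snd p, fst p) * indicator ({t0<..t} \<times> {t0<..s}) p \<partial>(lborel \<Otimes>\<^sub>M lborel))"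
      by (intro nn_integral_cong) (auto simp: indicator_def)
    finally have B: "emeasure M ?B
        = (\<integral>\<^sup>+p. Jb (snd p, fst p) * indicator ({t0<..t} \<times> {t0<..s}) p \<partial>(lborel \<Otimes>\<^sub>M lborel))" .
    \<comment> \<open>A tie at a finite time would put the path on both boundaries at once, but they
      never meet.\<close>
    have "Ta \<omega> \<noteq> Tb \<omega>" if "\<omega> \<in> space M" "Ta \<omega> \<le> ereal t" for \<omega>
    proof
      assume eq: "Ta \<omega> = Tb \<omega>"
      have X: "continuous_on {t0..} (\<lambda>t. X t \<omega>)"
        using that(1) by (rule continuous_X)
      have "ereal t0 \<le> Ta \<omega>"
        unfolding Ta_def by (rule hitting_time_ge)
      with that(2) obtain h where h: "Ta \<omega> = ereal h"
        by (cases "Ta \<omega>") auto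
      have "t0 \<le> h" "X h \<omega> = a h"
        using hitting_time_attained[OF cont(1) X] h unfolding Ta_def by auto
      moreover have "X h \<omega> = b h"
        using hitting_time_attained[OF cont(2) X] h eq unfolding Tb_def by auto
      ultimately show False
        using ne[of h] by simp
    qed
    then have "{\<omega> \<in> space M. Ta \<omega> \<le> ereal t \<and> Tb \<omega> \<le> ereal s} = ?A \<union> ?B"
      unfolding neq_iff by blast
    then have "emeasure M {\<omega> \<in> space M. Ta \<omega> \<le> ereal t \<and> Tb \<omega> \<le> ereal s} = emeasure M (?A \<union> ?B)"
      by simp
    also have "\<dots> = emeasure M ?A + emeasure M ?B"
      by (intro plus_emeasure[symmetric]) auto
    also have "\<dots> = (\<integral>\<^sup>+p. Ja p * indicator ({t0<..t} \<times> {t0<..s}) p \<partial>(lborel \<Otimes>\<^sub>M lborel))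
        + (\<integral>\<^sup>+p. Jb (snd p, fst p) * indicator ({t0<..t} \<times> {t0<..s}) p \<partial>(lborel \<Otimes>\<^sub>M lborel))"
      by (simp only: A B)
    also have "\<dots> = (\<integral>\<^sup>+p. Ja p * indicator ({t0<..t} \<times> {t0<..s}) p
        + Jb (snd p, fst p) * indicator ({t0<..t} \<times> {t0<..s}) p \<partial>(lborel \<Otimes>\<^sub>M lborel))"
      by (rule nn_integral_add[symmetric]) (rule box[OF Ja], rule box[OF Jb'])
    also have "\<dots> = (\<integral>\<^sup>+(u, v)\<in>{t0<..t} \<times> {t0<..s}. (Ja (u, v) + Jb (v, u)) \<partial>(lborel \<Otimes>\<^sub>M lborel))"
      by (intro nn_integral_cong) (auto simp: distrib_right)
    finally show "emeasure M {\<omega> \<in> space M. Ta \<omega> \<le> ereal t \<and> Tb \<omega> \<le> ereal s} = \<dots>" .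
  qed
qed

end

theorem theorem2p1:
  fixes r1 r2 :: ereal and Q :: "real \<Rightarrow> (real \<Rightarrow> real) measure"
    and M :: "'a measure" and t0 x0 :: real and X :: "real \<Rightarrow> 'a \<Rightarrow> real"
    and a b :: "real \<Rightarrow> real"
    and Ta Tb :: "'a \<Rightarrow> ereal"
    and fTa fTb :: "real \<Rightarrow> real \<Rightarrow> real \<Rightarrow> ennreal"
  assumes "diffusion_process r1 r2 Q M t0 x0 X"
    and "boundary (einterval r1 r2) t0 a" and "boundary (einterval r1 r2) t0 b"
    and "hitting_densities Q (einterval r1 r2) t0 a fTa"
    and "hitting_densities Q (einterval r1 r2) t0 b fTb"
  defines "Ta \<equiv> \<lambda>\<omega>. hitting_time t0 a (\<lambda>t. X t \<omega>)"
    and "Tb \<equiv> \<lambda>\<omega>. hitting_time t0 b (\<lambda>t. X t \<omega>)"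
  shows
    "(x0 < a t0 \<and> a t0 < b t0 \<and> (\<forall>t>t0. a t < b t) \<or>
      b t0 < a t0 \<and> a t0 < x0 \<and> (\<forall>t>t0. b t < a t) \<longrightarrow>
        joint_density_of M t0 Ta Tb
          (\<lambda>t s. if t \<ge> s then 0 else fTa t x0 t0 * fTb s (a t) t)) \<and>
     (a t0 < x0 \<and> x0 < b t0 \<and> (\<forall>t>t0. a t < b t) \<longrightarrow>
        (\<forall>ga gb.
           density_on M t0 Ta (\<lambda>\<omega>. Ta \<omega> < Tb \<omega>) ga \<longrightarrow>
           density_on M t0 Tb (\<lambda>\<omega>. Ta \<omega> > Tb \<omega>) gb \<longrightarrow>
           joint_density_of M t0 Ta Tb
             (\<lambda>t s. if t < s then fTb s (a t) t * ga t
                    else if t = s then 0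
                    else fTa t (b s) s * gb s)))"
proof -
  interpret diffusion_process r1 r2 Q M t0 x0 X
    by fact
  show ?thesis
  proof (intro conjI impI allI)
    assume order: "x0 < a t0 \<and> a t0 < b t0 \<and> (\<forall>t>t0. a t < b t) \<or>
      b t0 < a t0 \<and> a t0 < x0 \<and> (\<forall>t>t0. b t < a t)"
    \<comment> \<open>The inequality at \<open>t0\<close> and the one for later times combine into a
      single inequality for all \<open>t \<ge> t0\<close>.\<close>
    show "joint_density_of M t0 Ta Tb (\<lambda>t s. if t \<ge> s then 0 else fTa t x0 t0 * fTb s (a t) t)"
      unfolding Ta_def Tb_def
      by (rule joint_density_crossing; (fact | use order in \<open>force simp: order_le_less\<close>))
  next
    fix ga gb
    assume order: "a t0 < x0 \<and> x0 < b t0 \<and> (\<forall>t>t0. a t < b t)"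
      and dens: "density_on M t0 Ta (\<lambda>\<omega>. Ta \<omega> < Tb \<omega>) ga" "density_on M t0 Tb (\<lambda>\<omega>. Tb \<omega> < Ta \<omega>) gb"
    \<comment> \<open>At \<open>t0\<close> the boundaries are separated by \<open>x0\<close>;
      afterwards they are ordered by assumption.\<close>
    have "a t \<noteq> b t" if "t0 \<le> t" for t
      using order that by (cases "t = t0") (auto simp: less_le)
    then show "joint_density_of M t0 Ta Tb
        (\<lambda>t s. if t < s then fTb s (a t) t * ga t else if t = s then 0 else fTa t (b s) s * gb s)"
      using dens unfolding Ta_def Tb_def by (intro joint_density_exit assms(2-5))
  qed
qed

end
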